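(* Let $\mathcal{C}$ be a (small) category and let $\pi\colon\mathcal{C}\to\Pi_1(\mathcal{C})$ be the universal functor to its fundamental groupoid. The nerve $N\mathcal{C}$ admits a duplicial structure if and only if $\pi$ has a left adjoint.
   Context: The fundamental groupoid $\Pi_1(\mathcal{C})$ is the localisation of $\mathcal{C}$ at all of its morphisms, and $\pi$ is the canonical localisation functor. The nerve $N\mathcal{C}$ is the simplicial set whose set of $n$-simplices is the set of composable $n$-tuples $A_0\xrightarrow{f_0}A_1\xrightarrow{f_1}\cdots\xrightarrow{f_{n-1}}A_n$ of morphisms of $\mathcal{C}$ (objects of $\mathcal{C}$ when $n=0$), written $(f_{n-1},\dots,f_0)$. For $0\le i\le n$, the face map $d_i$ sends it to $(f_{n-1},\dots,f_1)$ if $i=0$, to $(f_{n-1},\dots,f_if_{i-1},\dots,f_0)$ if $0<i<n$, and to $(f_{n-2},\dots,f_0)$ if $i=n$ (for $n=1$: $d_0(f_0)=A_1$, $d_1(f_0)=A_0$); the degeneracy map is $s_i(f_{n-1},\dots,f_0)=(f_{n-1},\dots,f_i,1,f_{i-1},\dots,f_0)$. A duplicial structure on a simplicial object $X$ consists of a morphism $t\colon X_n\to X_n$ for each $n\ge 0$ such that $$d_it=\begin{cases} t d_{i-1} & 1\le i\le n\\ d_n & i=0\end{cases}\ (n\ge 1),\qquad s_jt=\begin{cases} t s_{j-1} & 1\le j\le n\\ t^2s_n & j=0\end{cases}\ (n\ge 0)$$ (on $X_n$). No invertibility of $t$ is required. *)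

theory Defs
  imports Main
begin

record ('o, 'a) cat =
  Obj :: "'o set"
  Arr :: "'a set"
  Dom :: "'a \<Rightarrow> 'o"
  Cod :: "'a \<Rightarrow> 'o"
  Ident :: "'o \<Rightarrow> 'a"
  Comp :: "'a \<Rightarrow> 'a \<Rightarrow> 'a"

text \<open>\<open>Comp C g f\<close> is the composite ``\<open>g\<close> after \<open>f\<close>''; it is only meaningful if \<open>Cod C f = Dom C g\<close>.\<close>

locale category =
  fixes C :: "('o, 'a) cat"
  assumes dom_obj: "f \<in> Arr C \<Longrightarrow> Dom C f \<in> Obj C"
    and cod_obj: "f \<in> Arr C \<Longrightarrow> Cod C f \<in> Obj C"
    and ident_arr: "A \<in> Obj C \<Longrightarrow> Ident C A \<in> Arr C"
    and dom_ident: "A \<in> Obj C \<Longrightarrow> Dom C (Ident C A) = A"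
    and cod_ident: "A \<in> Obj C \<Longrightarrow> Cod C (Ident C A) = A"
    and comp_arr: "\<lbrakk>f \<in> Arr C; g \<in> Arr C; Cod C f = Dom C g\<rbrakk> \<Longrightarrow> Comp C g f \<in> Arr C"
    and dom_comp: "\<lbrakk>f \<in> Arr C; g \<in> Arr C; Cod C f = Dom C g\<rbrakk> \<Longrightarrow> Dom C (Comp C g f) = Dom C f"
    and cod_comp: "\<lbrakk>f \<in> Arr C; g \<in> Arr C; Cod C f = Dom C g\<rbrakk> \<Longrightarrow> Cod C (Comp C g f) = Cod C g"
    and comp_ident: "f \<in> Arr C \<Longrightarrow> Comp C f (Ident C (Dom C f)) = f"
    and ident_comp: "f \<in> Arr C \<Longrightarrow> Comp C (Ident C (Cod C f)) f = f"
    and comp_assoc: "\<lbrakk>f \<in> Arr C; g \<in> Arr C; h \<in> Arr C; Cod C f = Dom C g; Cod C g = Dom C h\<rbrakk>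
      \<Longrightarrow> Comp C h (Comp C g f) = Comp C (Comp C h g) f"

definition inverse_arrows :: "('o, 'a) cat \<Rightarrow> 'a \<Rightarrow> 'a \<Rightarrow> bool" where
  "inverse_arrows C f g \<longleftrightarrow>
     f \<in> Arr C \<and> g \<in> Arr C \<and> Dom C g = Cod C f \<and> Cod C g = Dom C f \<and>
     Comp C g f = Ident C (Dom C f) \<and> Comp C f g = Ident C (Cod C f)"

definition iso_arrow :: "('o, 'a) cat \<Rightarrow> 'a \<Rightarrow> bool" where
  "iso_arrow C f \<longleftrightarrow> (\<exists>g. inverse_arrows C f g)"

definition groupoid :: "('o, 'a) cat \<Rightarrow> bool" where
  "groupoid C \<longleftrightarrow> category C \<and> (\<forall>f \<in> Arr C. iso_arrow C f)"

record ('o, 'a, 'p, 'b) func =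
  fobj :: "'o \<Rightarrow> 'p"
  farr :: "'a \<Rightarrow> 'b"

locale is_functor = src: category C + tgt: category D
  for C :: "('o, 'a) cat" and D :: "('p, 'b) cat" and F :: "('o, 'a, 'p, 'b) func" +
  assumes farr_arr: "f \<in> Arr C \<Longrightarrow> farr F f \<in> Arr D"
    and fobj_obj: "A \<in> Obj C \<Longrightarrow> fobj F A \<in> Obj D"
    and farr_dom: "f \<in> Arr C \<Longrightarrow> Dom D (farr F f) = fobj F (Dom C f)"
    and farr_cod: "f \<in> Arr C \<Longrightarrow> Cod D (farr F f) = fobj F (Cod C f)"
    and farr_ident: "A \<in> Obj C \<Longrightarrow> farr F (Ident C A) = Ident D (fobj F A)"
    and farr_comp: "\<lbrakk>f \<in> Arr C; g \<in> Arr C; Cod C f = Dom C g\<rbrakk>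
      \<Longrightarrow> farr F (Comp C g f) = Comp D (farr F g) (farr F f)"

definition id_func :: "('o, 'a, 'o, 'a) func" where
  "id_func = \<lparr>fobj = (\<lambda>A. A), farr = (\<lambda>f. f)\<rparr>"

definition comp_func ::
  "('p, 'b, 'q, 'c) func \<Rightarrow> ('o, 'a, 'p, 'b) func \<Rightarrow> ('o, 'a, 'q, 'c) func" where
  "comp_func G F = \<lparr>fobj = (\<lambda>A. fobj G (fobj F A)), farr = (\<lambda>f. farr G (farr F f))\<rparr>"

definition nat_trans ::
  "('o, 'a) cat \<Rightarrow> ('p, 'b) cat \<Rightarrow> ('o, 'a, 'p, 'b) func \<Rightarrow> ('o, 'a, 'p, 'b) func \<Rightarrow>
   ('o \<Rightarrow> 'b) \<Rightarrow> bool" where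
  "nat_trans C D F G \<alpha> \<longleftrightarrow>
     (\<forall>A \<in> Obj C. \<alpha> A \<in> Arr D \<and> Dom D (\<alpha> A) = fobj F A \<and> Cod D (\<alpha> A) = fobj G A) \<and>
     (\<forall>f \<in> Arr C. Comp D (farr G f) (\<alpha> (Dom C f)) = Comp D (\<alpha> (Cod C f)) (farr F f))"

text \<open>\<open>adjunction C D L R \<eta> \<epsilon>\<close>: the functor \<open>L : D \<rightarrow> C\<close> is left adjoint to \<open>R : C \<rightarrow> D\<close>,
  with unit \<open>\<eta>\<close> and counit \<open>\<epsilon>\<close> satisfying the triangle identities.\<close>

definition adjunction ::
  "('o, 'a) cat \<Rightarrow> ('p, 'b) cat \<Rightarrow> ('p, 'b, 'o, 'a) func \<Rightarrow> ('o, 'a, 'p, 'b) func \<Rightarrow>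
   ('p \<Rightarrow> 'b) \<Rightarrow> ('o \<Rightarrow> 'a) \<Rightarrow> bool" where
  "adjunction C D L R \<eta> \<epsilon> \<longleftrightarrow>
     is_functor C D R \<and> is_functor D C L \<and>
     nat_trans D D id_func (comp_func R L) \<eta> \<and>
     nat_trans C C (comp_func L R) id_func \<epsilon> \<and>
     (\<forall>X \<in> Obj D. Comp C (\<epsilon> (fobj L X)) (farr L (\<eta> X)) = Ident C (fobj L X)) \<and>
     (\<forall>A \<in> Obj C. Comp D (farr R (\<epsilon> A)) (\<eta> (fobj R A)) = Ident D (fobj R A))"

definition has_left_adjoint ::
  "('o, 'a) cat \<Rightarrow> ('p, 'b) cat \<Rightarrow> ('o, 'a, 'p, 'b) func \<Rightarrow> bool" where
  "has_left_adjoint C D R \<longleftrightarrow> (\<exists>L \<eta> \<epsilon>. adjunction C D L R \<eta> \<epsilon>)"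


text \<open>The localisation of \<open>C\<close> at all of its arrows has the objects of \<open>C\<close>; an arrow \<open>A \<rightarrow> B\<close> is a
  zigzag of arrows of \<open>C\<close> from \<open>A\<close> to \<open>B\<close>, modulo the least congruence that identifies forward steps
  with their composites and makes the backward step of \<open>f\<close> inverse to the forward step of \<open>f\<close>.
  Zigzags are lists of steps in the order in which they are traversed. The universal property is
  stated and proved in \<open>Pi1_universal\<close> below.\<close>

datatype 'a step = Fwd 'a | Bwd 'a

fun step_arr :: "'a step \<Rightarrow> 'a" where
  "step_arr (Fwd f) = f"
| "step_arr (Bwd f) = f"

fun step_src :: "('o, 'a) cat \<Rightarrow> 'a step \<Rightarrow> 'o" where
  "step_src C (Fwd f) = Dom C f"
| "step_src C (Bwd f) = Cod C f"

fun step_trg :: "('o, 'a) cat \<Rightarrow> 'a step \<Rightarrow> 'o" where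
  "step_trg C (Fwd f) = Cod C f"
| "step_trg C (Bwd f) = Dom C f"

fun zigzag :: "('o, 'a) cat \<Rightarrow> 'o \<Rightarrow> 'o \<Rightarrow> 'a step list \<Rightarrow> bool" where
  "zigzag C A B [] \<longleftrightarrow> A \<in> Obj C \<and> A = B"
| "zigzag C A B (x # w) \<longleftrightarrow> step_arr x \<in> Arr C \<and> step_src C x = A \<and> zigzag C (step_trg C x) B w"

inductive zz_eq :: "('o, 'a) cat \<Rightarrow> 'o \<Rightarrow> 'o \<Rightarrow> 'a step list \<Rightarrow> 'a step list \<Rightarrow> bool"
  for C :: "('o, 'a) cat" where
  zz_refl: "zigzag C A B w \<Longrightarrow> zz_eq C A B w w"
| zz_sym: "zz_eq C A B w w' \<Longrightarrow> zz_eq C A B w' w"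
| zz_trans: "\<lbrakk>zz_eq C A B w w'; zz_eq C A B w' w''\<rbrakk> \<Longrightarrow> zz_eq C A B w w''"
| zz_append: "\<lbrakk>zz_eq C A B u u'; zz_eq C B E v v'\<rbrakk> \<Longrightarrow> zz_eq C A E (u @ v) (u' @ v')"
| zz_comp: "\<lbrakk>f \<in> Arr C; g \<in> Arr C; Cod C f = Dom C g\<rbrakk>
    \<Longrightarrow> zz_eq C (Dom C f) (Cod C g) [Fwd f, Fwd g] [Fwd (Comp C g f)]"
| zz_ident: "A \<in> Obj C \<Longrightarrow> zz_eq C A A [Fwd (Ident C A)] []"
| zz_fwd_bwd: "f \<in> Arr C \<Longrightarrow> zz_eq C (Dom C f) (Dom C f) [Fwd f, Bwd f] []"
| zz_bwd_fwd: "f \<in> Arr C \<Longrightarrow> zz_eq C (Cod C f) (Cod C f) [Bwd f, Fwd f] []"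

type_synonym ('o, 'a) zz_arr = "'o \<times> 'o \<times> 'a step list set"

definition zz_class :: "('o, 'a) cat \<Rightarrow> 'o \<Rightarrow> 'o \<Rightarrow> 'a step list \<Rightarrow> ('o, 'a) zz_arr" where
  "zz_class C A B w = (A, B, {w'. zz_eq C A B w w'})"

definition Pi1 :: "('o, 'a) cat \<Rightarrow> ('o, ('o, 'a) zz_arr) cat" where
  "Pi1 C = \<lparr>
     Obj = Obj C,
     Arr = {zz_class C A B w |A B w. zigzag C A B w},
     Dom = (\<lambda>(A, B, W). A),
     Cod = (\<lambda>(A, B, W). B),
     Ident = (\<lambda>A. zz_class C A A []),
     Comp = (\<lambda>(B', E, V) (A, B, U). (A, E, {w. \<exists>u \<in> U. \<exists>v \<in> V. zz_eq C A E (u @ v) w}))\<rparr>"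

definition pi_func :: "('o, 'a) cat \<Rightarrow> ('o, 'a, 'o, ('o, 'a) zz_arr) func" where
  "pi_func C = \<lparr>fobj = (\<lambda>A. A), farr = (\<lambda>f. zz_class C (Dom C f) (Cod C f) [Fwd f])\<rparr>"


text \<open>\<open>Face X n i\<close> and \<open>Degen X n i\<close> are \<open>d\<^sub>i\<close> and \<open>s\<^sub>i\<close> on the \<open>n\<close>-simplices of \<open>X\<close>.\<close>

record 'x sset =
  Simp :: "nat \<Rightarrow> 'x set"
  Face :: "nat \<Rightarrow> nat \<Rightarrow> 'x \<Rightarrow> 'x"
  Degen :: "nat \<Rightarrow> nat \<Rightarrow> 'x \<Rightarrow> 'x"

locale simplicial_set =
  fixes X :: "'x sset"
  assumes face_simp: "\<lbrakk>1 \<le> n; i \<le> n; x \<in> Simp X n\<rbrakk> \<Longrightarrow> Face X n i x \<in> Simp X (n - 1)"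
    and degen_simp: "\<lbrakk>i \<le> n; x \<in> Simp X n\<rbrakk> \<Longrightarrow> Degen X n i x \<in> Simp X (n + 1)"
    and face_face: "\<lbrakk>2 \<le> n; i < j; j \<le> n; x \<in> Simp X n\<rbrakk>
      \<Longrightarrow> Face X (n - 1) i (Face X n j x) = Face X (n - 1) (j - 1) (Face X n i x)"
    and degen_degen: "\<lbrakk>i \<le> j; j \<le> n; x \<in> Simp X n\<rbrakk>
      \<Longrightarrow> Degen X (n + 1) i (Degen X n j x) = Degen X (n + 1) (j + 1) (Degen X n i x)"
    and face_degen_less: "\<lbrakk>i < j; j \<le> n; x \<in> Simp X n\<rbrakk>
      \<Longrightarrow> Face X (n + 1) i (Degen X n j x) = Degen X (n - 1) (j - 1) (Face X n i x)"
    and face_degen_id: "\<lbrakk>i = j \<or> i = j + 1; j \<le> n; x \<in> Simp X n\<rbrakk>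
      \<Longrightarrow> Face X (n + 1) i (Degen X n j x) = x"
    and face_degen_greater: "\<lbrakk>j + 1 < i; i \<le> n + 1; x \<in> Simp X n\<rbrakk>
      \<Longrightarrow> Face X (n + 1) i (Degen X n j x) = Degen X (n - 1) j (Face X n (i - 1) x)"

definition duplicial_structure :: "'x sset \<Rightarrow> (nat \<Rightarrow> 'x \<Rightarrow> 'x) \<Rightarrow> bool" where
  "duplicial_structure X t \<longleftrightarrow>
     (\<forall>n. \<forall>x \<in> Simp X n. t n x \<in> Simp X n) \<and>
     (\<forall>n \<ge> 1. \<forall>x \<in> Simp X n.
        (\<forall>i. 1 \<le> i \<and> i \<le> n \<longrightarrow> Face X n i (t n x) = t (n - 1) (Face X n (i - 1) x)) \<and>
        Face X n 0 (t n x) = Face X n n x) \<and>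
     (\<forall>n. \<forall>x \<in> Simp X n.
        (\<forall>j. 1 \<le> j \<and> j \<le> n \<longrightarrow> Degen X n j (t n x) = t (n + 1) (Degen X n (j - 1) x)) \<and>
        Degen X n 0 (t n x) = t (n + 1) (t (n + 1) (Degen X n n x)))"

text \<open>The \<open>n\<close>-simplex \<open>A\<^sub>0 \<rightarrow> \<dots> \<rightarrow> A\<^sub>n\<close> with arrows \<open>f\<^sub>0, \<dots>, f\<^sub>n\<^sub>-\<^sub>1\<close> is encoded as \<open>(A\<^sub>0, [f\<^sub>0, \<dots>, f\<^sub>n\<^sub>-\<^sub>1])\<close>.
  The first component is determined by the second if \<open>n \<ge> 1\<close>, and is the object itself if \<open>n = 0\<close>.\<close>

type_synonym ('o, 'a) path = "'o \<times> 'a list"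

definition vertex :: "('o, 'a) cat \<Rightarrow> ('o, 'a) path \<Rightarrow> nat \<Rightarrow> 'o" where
  "vertex C p i = (if i = 0 then fst p else Cod C (snd p ! (i - 1)))"

definition is_path :: "('o, 'a) cat \<Rightarrow> ('o, 'a) path \<Rightarrow> bool" where
  "is_path C p \<longleftrightarrow> fst p \<in> Obj C \<and> set (snd p) \<subseteq> Arr C \<and>
     (\<forall>i < length (snd p). Dom C (snd p ! i) = vertex C p i)"

definition path_face :: "('o, 'a) cat \<Rightarrow> nat \<Rightarrow> nat \<Rightarrow> ('o, 'a) path \<Rightarrow> ('o, 'a) path" where
  "path_face C n i p =
     (if i = 0 then (vertex C p 1, tl (snd p))
      else if i = n then (fst p, butlast (snd p))
      else (fst p, take (i - 1) (snd p) @ [Comp C (snd p ! i) (snd p ! (i - 1))] @ drop (i + 1) (snd p)))"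

definition path_degen :: "('o, 'a) cat \<Rightarrow> nat \<Rightarrow> nat \<Rightarrow> ('o, 'a) path \<Rightarrow> ('o, 'a) path" where
  "path_degen C n i p = (fst p, take i (snd p) @ [Ident C (vertex C p i)] @ drop i (snd p))"

definition nerve :: "('o, 'a) cat \<Rightarrow> ('o, 'a) path sset" where
  "nerve C = \<lparr>
     Simp = (\<lambda>n. {p. is_path C p \<and> length (snd p) = n}),
     Face = path_face C,
     Degen = path_degen C\<rparr>"

lemma zigzag_append: "zigzag C A B u \<Longrightarrow> zigzag C B E v \<Longrightarrow> zigzag C A E (u @ v)"
  by (induction u arbitrary: A) auto

context category
begin

lemma step_src_obj: "step_arr x \<in> Arr C \<Longrightarrow> step_src C x \<in> Obj C"
  by (cases x) (auto simp: dom_obj cod_obj)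

lemma step_trg_obj: "step_arr x \<in> Arr C \<Longrightarrow> step_trg C x \<in> Obj C"
  by (cases x) (auto simp: dom_obj cod_obj)

lemma zigzag_obj: "zigzag C A B w \<Longrightarrow> A \<in> Obj C \<and> B \<in> Obj C"
  by (induction w arbitrary: A) (auto simp: step_src_obj)

lemma zz_eq_zigzag: "zz_eq C A B w w' \<Longrightarrow> zigzag C A B w \<and> zigzag C A B w'"
  by (induction rule: zz_eq.induct)
    (auto intro: zigzag_append
      simp: dom_obj cod_obj comp_arr dom_comp cod_comp ident_arr dom_ident cod_ident)

lemma zz_class_eq_iff:
  assumes "zigzag C A B w"
  shows "zz_class C A B w = zz_class C A B w' \<longleftrightarrow> zz_eq C A B w w'"
  using assms unfolding zz_class_def
  by (auto intro: zz_refl zz_sym zz_trans)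

lemma Comp_zz_class:
  assumes "zigzag C A B u" "zigzag C B E v"
  shows "Comp (Pi1 C) (zz_class C B E v) (zz_class C A B u) = zz_class C A E (u @ v)"
  using assms unfolding Pi1_def zz_class_def
  by (auto intro: zz_refl zz_trans zz_append)

lemma Pi1_simps:
  "Obj (Pi1 C) = Obj C"
  "Dom (Pi1 C) (zz_class C A B w) = A"
  "Cod (Pi1 C) (zz_class C A B w) = B"
  "Ident (Pi1 C) A = zz_class C A A []"
  by (simp_all add: Pi1_def zz_class_def)

lemma Arr_Pi1I: "zigzag C A B w \<Longrightarrow> zz_class C A B w \<in> Arr (Pi1 C)"
  by (auto simp: Pi1_def)

lemma Arr_Pi1E:
  assumes "F \<in> Arr (Pi1 C)"
  obtains A B w where "zigzag C A B w" "F = zz_class C A B w"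
  using assms by (auto simp: Pi1_def)

lemma category_Pi1: "category (Pi1 C)"
proof
  fix f assume "f \<in> Arr (Pi1 C)"
  then obtain A B u where f: "zigzag C A B u" "f = zz_class C A B u" by (rule Arr_Pi1E)
  have o: "A \<in> Obj C" "B \<in> Obj C" using zigzag_obj[OF f(1)] by auto
  show "Dom (Pi1 C) f \<in> Obj (Pi1 C)" "Cod (Pi1 C) f \<in> Obj (Pi1 C)"
    using f o by (simp_all add: Pi1_simps)
  show "Comp (Pi1 C) f (Ident (Pi1 C) (Dom (Pi1 C) f)) = f"
    "Comp (Pi1 C) (Ident (Pi1 C) (Cod (Pi1 C) f)) f = f"
    using f o by (simp_all add: Pi1_simps Comp_zz_class)
  fix g assume "g \<in> Arr (Pi1 C)" and fg: "Cod (Pi1 C) f = Dom (Pi1 C) g"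
  then obtain B' E v where "zigzag C B' E v" "g = zz_class C B' E v" by (auto elim: Arr_Pi1E)
  with fg f have g: "zigzag C B E v" "g = zz_class C B E v" by (auto simp: Pi1_simps)
  note uv = zigzag_append[OF f(1) g(1)]
  show "Comp (Pi1 C) g f \<in> Arr (Pi1 C)"
    "Dom (Pi1 C) (Comp (Pi1 C) g f) = Dom (Pi1 C) f"
    "Cod (Pi1 C) (Comp (Pi1 C) g f) = Cod (Pi1 C) g"
    using f g uv by (simp_all add: Pi1_simps Comp_zz_class Arr_Pi1I)
  fix h assume "h \<in> Arr (Pi1 C)" and gh: "Cod (Pi1 C) g = Dom (Pi1 C) h"
  then obtain E' K w where "zigzag C E' K w" "h = zz_class C E' K w" by (auto elim: Arr_Pi1E)
  with gh g have h: "zigzag C E K w" "h = zz_class C E K w" by (auto simp: Pi1_simps)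
  show "Comp (Pi1 C) h (Comp (Pi1 C) g f) = Comp (Pi1 C) (Comp (Pi1 C) h g) f"
    using f g h uv zigzag_append[OF g(1) h(1)] by (simp add: Comp_zz_class)
next
  fix A assume A: "A \<in> Obj (Pi1 C)"
  then show "Ident (Pi1 C) A \<in> Arr (Pi1 C)"
    by (auto simp: Pi1_simps intro!: Arr_Pi1I)
  show "Dom (Pi1 C) (Ident (Pi1 C) A) = A" "Cod (Pi1 C) (Ident (Pi1 C) A) = A"
    by (simp_all add: Pi1_simps)
qed

fun rev_step :: "'x step \<Rightarrow> 'x step" where
  "rev_step (Fwd f) = Bwd f"
| "rev_step (Bwd f) = Fwd f"

lemma step_cancel:
  assumes "step_arr x \<in> Arr C"
  shows "zz_eq C (step_src C x) (step_src C x) [x, rev_step x] []"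
  using assms by (cases x) (auto intro: zz_fwd_bwd zz_bwd_fwd)

lemma rev_step_simps:
  "step_arr (rev_step x) = step_arr x"
  "step_src C (rev_step x) = step_trg C x"
  "step_trg C (rev_step x) = step_src C x"
  "rev_step (rev_step x) = x"
  by (cases x; simp)+

lemma zigzag_rev:
  "zigzag C A B w \<Longrightarrow> zigzag C B A (rev (map rev_step w))"
proof (induction w arbitrary: A)
  case (Cons x w)
  then show ?case
    by (auto intro!: zigzag_append simp: rev_step_simps step_src_obj)
qed auto

lemma zigzag_cancel:
  "zigzag C A B w \<Longrightarrow> zz_eq C A A (w @ rev (map rev_step w)) []"
proof (induction w arbitrary: A)
  case Nil
  then show ?case by (auto intro: zz_refl)
next
  case (Cons x w)
  let ?S = "step_src C x" and ?T = "step_trg C x"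
  have x: "step_arr x \<in> Arr C" "A = ?S" and w: "zigzag C ?T B w" using Cons.prems by auto
  have zx: "zz_eq C ?S ?T [x] [x]" and zr: "zz_eq C ?T ?S [rev_step x] [rev_step x]"
    using x by (auto intro!: zz_refl simp: rev_step_simps step_src_obj step_trg_obj)
  have "zz_eq C ?S ?S ([x] @ (w @ rev (map rev_step w)) @ [rev_step x]) ([x] @ [] @ [rev_step x])"
    by (intro zz_append[OF zx] zz_append[OF _ zr] Cons.IH w)
  with zz_trans[OF this] step_cancel[OF x(1)] x show ?case by simp
qed

theorem groupoid_Pi1: "groupoid (Pi1 C)"
  unfolding groupoid_def iso_arrow_def
proof (intro conjI ballI category_Pi1)
  fix f assume "f \<in> Arr (Pi1 C)"
  then obtain A B w where f: "zigzag C A B w" "f = zz_class C A B w" by (rule Arr_Pi1E)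
  let ?r = "rev (map rev_step w)"
  note r = zigzag_rev[OF f(1)]
  have "rev (map rev_step ?r) = w" by (simp add: rev_map o_def rev_step_simps)
  with zigzag_cancel[OF r] have 1: "zz_eq C B B (?r @ w) []" by simp
  have "zz_class C A A (w @ ?r) = zz_class C A A []" "zz_class C B B (?r @ w) = zz_class C B B []"
    using zigzag_cancel[OF f(1)] 1 f(1) r by (auto simp: zz_class_eq_iff zigzag_append)
  then have "inverse_arrows (Pi1 C) f (zz_class C B A ?r)"
    using f r unfolding inverse_arrows_def by (simp add: Pi1_simps Comp_zz_class Arr_Pi1I)
  then show "\<exists>g. inverse_arrows (Pi1 C) f g" by blast
qed

theorem functor_pi_func: "is_functor C (Pi1 C) (pi_func C)"
proof (intro is_functor.intro is_functor_axioms.intro category_Pi1)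
  show "category C" by (rule category_axioms)
  show "farr (pi_func C) f \<in> Arr (Pi1 C)" if "f \<in> Arr C" for f
    using that by (auto simp: pi_func_def cod_obj intro!: Arr_Pi1I)
  show "fobj (pi_func C) A \<in> Obj (Pi1 C)" if "A \<in> Obj C" for A
    using that by (simp add: pi_func_def Pi1_simps)
  show "Dom (Pi1 C) (farr (pi_func C) f) = fobj (pi_func C) (Dom C f)"
    "Cod (Pi1 C) (farr (pi_func C) f) = fobj (pi_func C) (Cod C f)" for f
    by (simp_all add: pi_func_def Pi1_simps)
  show "farr (pi_func C) (Ident C A) = Ident (Pi1 C) (fobj (pi_func C) A)" if "A \<in> Obj C" for A
    using that zz_eq_zigzag[OF zz_ident[OF that]] zz_ident[OF that]
    by (simp add: pi_func_def Pi1_simps dom_ident cod_ident zz_class_eq_iff)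
  show "farr (pi_func C) (Comp C g f) = Comp (Pi1 C) (farr (pi_func C) g) (farr (pi_func C) f)"
    if "f \<in> Arr C" "g \<in> Arr C" "Cod C f = Dom C g" for f g
  proof -
    have "zigzag C (Dom C f) (Cod C f) [Fwd f]" "zigzag C (Cod C f) (Cod C g) [Fwd g]"
      using that cod_obj[of f] cod_obj[of g] by auto
    from Comp_zz_class[OF this] zz_sym[OF zz_comp[OF that]] zz_eq_zigzag[OF zz_comp[OF that]]
    show ?thesis
      using that by (simp add: pi_func_def dom_comp cod_comp zz_class_eq_iff)
  qed
qed

lemma inverse_arrows_unique:
  assumes "inverse_arrows C f g" "inverse_arrows C f h"
  shows "g = h"
proof -
  have "g = Comp C g (Comp C f h)"
    using assms comp_ident[of g] by (simp add: inverse_arrows_def)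
  also have "\<dots> = Comp C (Comp C g f) h"
    using assms by (intro comp_assoc) (auto simp: inverse_arrows_def)
  also have "\<dots> = h"
    using assms ident_comp[of h] by (simp add: inverse_arrows_def)
  finally show ?thesis .
qed

end

definition inv_arrow :: "('o, 'a) cat \<Rightarrow> 'a \<Rightarrow> 'a" where
  "inv_arrow C f = (SOME g. inverse_arrows C f g)"

lemma inv_arrow: "iso_arrow C f \<Longrightarrow> inverse_arrows C f (inv_arrow C f)"
  unfolding iso_arrow_def inv_arrow_def by (rule someI_ex)

context is_functor
begin

fun eval_step :: "'a step \<Rightarrow> 'b" where
  "eval_step (Fwd f) = farr F f"
| "eval_step (Bwd f) = inv_arrow D (farr F f)"

fun eval_zz :: "'o \<Rightarrow> 'a step list \<Rightarrow> 'b" where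
  "eval_zz B [] = Ident D (fobj F B)"
| "eval_zz B (x # w) = Comp D (eval_zz B w) (eval_step x)"

context
  assumes inverts: "\<And>f. f \<in> Arr C \<Longrightarrow> iso_arrow D (farr F f)"
begin

lemma inverts': "f \<in> Arr C \<Longrightarrow> inverse_arrows D (farr F f) (inv_arrow D (farr F f))"
  by (intro inv_arrow inverts)

lemma eval_step:
  assumes "step_arr x \<in> Arr C"
  shows "eval_step x \<in> Arr D" "Dom D (eval_step x) = fobj F (step_src C x)"
    "Cod D (eval_step x) = fobj F (step_trg C x)"
  using assms inverts'[of "step_arr x"]
  by (cases x; simp add: farr_arr farr_dom farr_cod inverse_arrows_def)+

lemma eval_zz:
  assumes "zigzag C A B w"
  shows "eval_zz B w \<in> Arr D \<and> Dom D (eval_zz B w) = fobj F A \<and> Cod D (eval_zz B w) = fobj F B"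
  using assms
  by (induction w arbitrary: A)
    (auto simp: eval_step fobj_obj tgt.ident_arr tgt.dom_ident tgt.cod_ident
      tgt.comp_arr tgt.dom_comp tgt.cod_comp)

lemma eval_zz_append:
  assumes "zigzag C A B u" "zigzag C B E v"
  shows "eval_zz E (u @ v) = Comp D (eval_zz E v) (eval_zz B u)"
  using assms
proof (induction u arbitrary: A)
  case Nil
  then show ?case using eval_zz[OF Nil(2)] tgt.comp_ident[of "eval_zz E v"] by simp
next
  case (Cons x u)
  then have "zigzag C (step_trg C x) B u" and x: "step_arr x \<in> Arr C" by auto
  note u = eval_zz[OF this(1)] and IH = Cons.IH[OF this(1) Cons.prems(2)]
  show ?case
    using eval_step[OF x] u eval_zz[OF Cons.prems(2)] IH
    by (simp add: tgt.comp_assoc)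
qed

lemma eval_zz_single:
  "step_arr x \<in> Arr C \<Longrightarrow> eval_zz (step_trg C x) [x] = eval_step x"
  using eval_step[of x] tgt.ident_comp[of "eval_step x"] by simp

lemma eval_zz_pair:
  assumes "step_arr x \<in> Arr C" "step_arr y \<in> Arr C" "step_trg C x = step_src C y"
  shows "eval_zz (step_trg C y) [x, y] = Comp D (eval_step y) (eval_step x)"
  using assms eval_zz_single[of y] by simp

lemma eval_zz_eq: "zz_eq C A B w w' \<Longrightarrow> eval_zz B w = eval_zz B w'"
proof (induction rule: zz_eq.induct)
  case (zz_append A B u u' E v v')
  then show ?case using src.zz_eq_zigzag by (metis eval_zz_append)
next
  case (zz_comp f g)
  then show ?case
    using eval_zz_pair[of "Fwd f" "Fwd g"] eval_zz_single[of "Fwd (Comp C g f)"]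
    by (simp add: src.comp_arr src.cod_comp farr_comp)
next
  case (zz_ident A)
  then show ?case
    using eval_zz_single[of "Fwd (Ident C A)"]
    by (simp add: src.ident_arr src.cod_ident farr_ident)
next
  case (zz_fwd_bwd f)
  then show ?case
    using eval_zz_pair[of "Fwd f" "Bwd f"] inverts'[of f]
    by (simp add: inverse_arrows_def farr_dom)
next
  case (zz_bwd_fwd f)
  then show ?case
    using eval_zz_pair[of "Bwd f" "Fwd f"] inverts'[of f]
    by (simp add: inverse_arrows_def farr_cod)
qed simp_all

definition Pi1_lift :: "('o, ('o, 'a) zz_arr, 'p, 'b) func" where
  "Pi1_lift = \<lparr>fobj = fobj F, farr = (\<lambda>(A, B, W). eval_zz B (SOME w. w \<in> W))\<rparr>"

lemma Pi1_lift_class: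
  assumes "zigzag C A B w"
  shows "farr Pi1_lift (zz_class C A B w) = eval_zz B w"
proof -
  have "zz_eq C A B w (SOME w'. zz_eq C A B w w')"
    by (rule someI) (rule zz_refl[OF assms])
  then show ?thesis by (simp add: Pi1_lift_def zz_class_def eval_zz_eq[symmetric])
qed

lemma functor_Pi1_lift: "is_functor (Pi1 C) D Pi1_lift"
proof (intro is_functor.intro is_functor_axioms.intro src.category_Pi1 tgt.category_axioms)
  show "fobj Pi1_lift A \<in> Obj D" if "A \<in> Obj (Pi1 C)" for A
    using that by (simp add: Pi1_lift_def src.Pi1_simps fobj_obj)
  show "farr Pi1_lift (Ident (Pi1 C) A) = Ident D (fobj Pi1_lift A)" if "A \<in> Obj (Pi1 C)" for A
    using that Pi1_lift_class[of A A "[]"] by (simp add: src.Pi1_simps) (simp add: Pi1_lift_def)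
  fix f assume "f \<in> Arr (Pi1 C)"
  then obtain A B u where f: "zigzag C A B u" "f = zz_class C A B u" by (rule src.Arr_Pi1E)
  show "farr Pi1_lift f \<in> Arr D"
    "Dom D (farr Pi1_lift f) = fobj Pi1_lift (Dom (Pi1 C) f)"
    "Cod D (farr Pi1_lift f) = fobj Pi1_lift (Cod (Pi1 C) f)"
    using f eval_zz[OF f(1)]
    by (simp_all add: Pi1_lift_class src.Pi1_simps) (simp_all add: Pi1_lift_def)
  fix g assume "g \<in> Arr (Pi1 C)" and fg: "Cod (Pi1 C) f = Dom (Pi1 C) g"
  then obtain B' E v where "zigzag C B' E v" "g = zz_class C B' E v" by (auto elim: src.Arr_Pi1E)
  with fg f have g: "zigzag C B E v" "g = zz_class C B E v" by (auto simp: src.Pi1_simps)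
  show "farr Pi1_lift (Comp (Pi1 C) g f) = Comp D (farr Pi1_lift g) (farr Pi1_lift f)"
    using f g by (simp add: src.Comp_zz_class Pi1_lift_class zigzag_append eval_zz_append)
qed

lemma Pi1_lift_pi_func:
  "A \<in> Obj C \<Longrightarrow> fobj (comp_func Pi1_lift (pi_func C)) A = fobj F A"
  "f \<in> Arr C \<Longrightarrow> farr (comp_func Pi1_lift (pi_func C)) f = farr F f"
  using Pi1_lift_class[of "Dom C f" "Cod C f" "[Fwd f]"] eval_zz_single[of "Fwd f"]
  by (simp_all add: comp_func_def pi_func_def src.cod_obj) (simp add: Pi1_lift_def)

end

lemma functor_inverse:
  "inverse_arrows C f g \<Longrightarrow> inverse_arrows D (farr F f) (farr F g)"
  unfolding inverse_arrows_def
  by (metis farr_arr farr_cod farr_comp farr_dom farr_ident src.cod_obj src.dom_obj)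

end

lemma (in category) Pi1_functor_unique:
  assumes K: "is_functor (Pi1 C) D K" and K': "is_functor (Pi1 C) D K'"
    and obj: "\<And>A. A \<in> Obj C \<Longrightarrow> fobj (comp_func K (pi_func C)) A = fobj (comp_func K' (pi_func C)) A"
    and arr: "\<And>f. f \<in> Arr C \<Longrightarrow> farr (comp_func K (pi_func C)) f = farr (comp_func K' (pi_func C)) f"
  shows "\<forall>A \<in> Obj (Pi1 C). fobj K A = fobj K' A" "\<forall>f \<in> Arr (Pi1 C). farr K f = farr K' f"
proof -
  interpret K: is_functor "Pi1 C" D K by fact
  interpret K': is_functor "Pi1 C" D K' by fact
  show o: "\<forall>A \<in> Obj (Pi1 C). fobj K A = fobj K' A"
    using obj by (simp add: comp_func_def pi_func_def Pi1_simps)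
  have step: "farr K (zz_class C (step_src C x) (step_trg C x) [x]) =
      farr K' (zz_class C (step_src C x) (step_trg C x) [x])" if x: "step_arr x \<in> Arr C" for x
  proof (cases x)
    case (Fwd f)
    then show ?thesis using arr[of f] x by (simp add: comp_func_def pi_func_def)
  next
    case (Bwd f)
    then have f: "f \<in> Arr C" using x by simp
    let ?p = "zz_class C (Dom C f) (Cod C f) [Fwd f]"
    let ?q = "zz_class C (Cod C f) (Dom C f) [Bwd f]"
    have z: "zigzag C (Dom C f) (Cod C f) [Fwd f]" "zigzag C (Cod C f) (Dom C f) [Bwd f]"
      using f by (auto simp: dom_obj cod_obj)
    have "inverse_arrows (Pi1 C) ?p ?q"
      using z f zz_fwd_bwd[OF f] zz_bwd_fwd[OF f] zigzag_append[OF z] zigzag_append[OF z(2,1)]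
      unfolding inverse_arrows_def
      by (simp add: Pi1_simps Comp_zz_class Arr_Pi1I zz_class_eq_iff)
    then have "inverse_arrows D (farr K ?p) (farr K ?q)" "inverse_arrows D (farr K' ?p) (farr K' ?q)"
      by (rule K.functor_inverse K'.functor_inverse)+
    moreover have "farr K ?p = farr K' ?p" using arr[OF f] by (simp add: comp_func_def pi_func_def)
    ultimately show ?thesis using Bwd K.tgt.inverse_arrows_unique by auto
  qed
  have "farr K (zz_class C A B w) = farr K' (zz_class C A B w)" if "zigzag C A B w" for A B w
    using that
  proof (induction w arbitrary: A)
    case Nil
    then show ?case
      using K.farr_ident[of A] K'.farr_ident[of A] o by (auto simp: Pi1_simps)
  next
    case (Cons x w)
    then have z: "zigzag C (step_src C x) (step_trg C x) [x]" "zigzag C (step_trg C x) B w"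
      and A: "A = step_src C x" and x: "step_arr x \<in> Arr C"
      by (auto simp: step_trg_obj)
    have "zz_class C A B (x # w) =
        Comp (Pi1 C) (zz_class C (step_trg C x) B w) (zz_class C (step_src C x) (step_trg C x) [x])"
      using Comp_zz_class[OF z] A by simp
    then show ?case
      using z Cons.IH[OF z(2)] step[OF x]
      by (simp add: K.farr_comp K'.farr_comp Arr_Pi1I Pi1_simps)
  qed
  then show "\<forall>f \<in> Arr (Pi1 C). farr K f = farr K' f" by (auto elim!: Arr_Pi1E)
qed

text \<open>\<open>pi_func C\<close> inverts every arrow of \<open>C\<close> (by \<open>groupoid_Pi1\<close>), and every functor that does so factors
  uniquely through \<open>pi_func C\<close>.\<close>

theorem Pi1_universal:
  assumes F: "is_functor C D F" and inv: "\<And>f. f \<in> Arr C \<Longrightarrow> iso_arrow D (farr F f)"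
  shows "\<exists>K. is_functor (Pi1 C) D K \<and>
      (\<forall>A \<in> Obj C. fobj (comp_func K (pi_func C)) A = fobj F A) \<and>
      (\<forall>f \<in> Arr C. farr (comp_func K (pi_func C)) f = farr F f) \<and>
      (\<forall>K'. is_functor (Pi1 C) D K' \<and>
        (\<forall>A \<in> Obj C. fobj (comp_func K' (pi_func C)) A = fobj F A) \<and>
        (\<forall>f \<in> Arr C. farr (comp_func K' (pi_func C)) f = farr F f) \<longrightarrow>
        (\<forall>A \<in> Obj (Pi1 C). fobj K' A = fobj K A) \<and> (\<forall>f \<in> Arr (Pi1 C). farr K' f = farr K f))"
proof -
  interpret F: is_functor C D F by fact
  let ?K = "F.Pi1_lift"
  note 1 = F.functor_Pi1_lift[OF inv] and 2 = F.Pi1_lift_pi_func[OF inv]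
  show ?thesis
  proof (rule exI[of _ ?K], intro conjI allI impI)
    show "is_functor (Pi1 C) D ?K" by (rule 1)
    show "\<forall>A \<in> Obj C. fobj (comp_func ?K (pi_func C)) A = fobj F A" using 2 by blast
    show "\<forall>f \<in> Arr C. farr (comp_func ?K (pi_func C)) f = farr F f" using 2 by blast
  next
    fix K'
    assume K': "is_functor (Pi1 C) D K' \<and>
        (\<forall>A \<in> Obj C. fobj (comp_func K' (pi_func C)) A = fobj F A) \<and>
        (\<forall>f \<in> Arr C. farr (comp_func K' (pi_func C)) f = farr F f)"
    then show "\<forall>A \<in> Obj (Pi1 C). fobj K' A = fobj ?K A"
      by (intro F.src.Pi1_functor_unique(1)[OF _ 1]) (auto simp: 2)
    from K' show "\<forall>f \<in> Arr (Pi1 C). farr K' f = farr ?K f"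
      by (intro F.src.Pi1_functor_unique(2)[OF _ 1]) (auto simp: 2)
  qed
qed

context category
begin

lemma Simp_nerve: "p \<in> Simp (nerve C) n \<longleftrightarrow> is_path C p \<and> length (snd p) = n"
  by (simp add: nerve_def)

lemma path_eqI:
  assumes "fst p = fst q" "length (snd p) = length (snd q)"
    "\<And>k. k < length (snd p) \<Longrightarrow> snd p ! k = snd q ! k"
  shows "p = q"
  using assms nth_equalityI[of "snd p" "snd q"] by (auto intro: prod_eqI)

lemma path_arr: "\<lbrakk>is_path C p; k < length (snd p)\<rbrakk> \<Longrightarrow> snd p ! k \<in> Arr C"
  by (auto simp: is_path_def)

lemma path_dom: "\<lbrakk>is_path C p; k < length (snd p)\<rbrakk> \<Longrightarrow> Dom C (snd p ! k) = vertex C p k"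
  by (auto simp: is_path_def)

lemma path_cod: "Cod C (snd p ! k) = vertex C p (k + 1)"
  by (simp add: vertex_def)

lemma vertex_obj: "\<lbrakk>is_path C p; k \<le> length (snd p)\<rbrakk> \<Longrightarrow> vertex C p k \<in> Obj C"
  using cod_obj path_arr[of p "k - 1"] by (auto simp: vertex_def is_path_def)

lemma is_pathI:
  assumes "vertex C p 0 \<in> Obj C"
    "\<And>k. k < length (snd p) \<Longrightarrow> snd p ! k \<in> Arr C \<and> Dom C (snd p ! k) = vertex C p k"
  shows "is_path C p"
  using assms by (auto simp: is_path_def in_set_conv_nth vertex_def)

lemma length_face:
  "\<lbrakk>1 \<le> n; i \<le> n; length (snd p) = n\<rbrakk> \<Longrightarrow> length (snd (path_face C n i p)) = n - 1"
  by (auto simp: path_face_def)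

lemma nth_face:
  assumes "i \<le> n" "length (snd p) = n" "k < n - 1"
  shows "snd (path_face C n i p) ! k =
    (if k + 1 < i then snd p ! k
     else if k + 1 = i then Comp C (snd p ! (k + 1)) (snd p ! k)
     else snd p ! (k + 1))"
proof -
  have "k < length (take (i - 1) (snd p)) \<longleftrightarrow> k + 1 < i" "length (take (i - 1) (snd p)) = i - 1"
    if "i \<noteq> 0" "i \<noteq> n" using that assms by auto
  then show ?thesis
    using assms by (auto simp: path_face_def nth_tl nth_butlast nth_append nth_Cons')
qed

lemma vertex_face:
  assumes "1 \<le> n" "i \<le> n" "is_path C p" "length (snd p) = n" "k \<le> n - 1"
  shows "vertex C (path_face C n i p) k = vertex C p (if k < i then k else k + 1)"
proof (cases "k = 0")
  case True
  then show ?thesis using assms by (auto simp: vertex_def path_face_def)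
next
  case False
  then have k: "k - 1 < n - 1" using assms by auto
  have "Cod C (Comp C (snd p ! k) (snd p ! (k - 1))) = Cod C (snd p ! k)" if "k < n"
    using that assms False path_arr[of p k] path_arr[of p "k - 1"] path_dom[of p k]
    by (intro cod_comp) (auto simp: vertex_def)
  then show ?thesis
    using nth_face[OF assms(2,4) k] False assms(5) k by (auto simp: vertex_def)
qed

lemma length_degen: "i \<le> length (snd p) \<Longrightarrow> length (snd (path_degen C n i p)) = length (snd p) + 1"
  by (simp add: path_degen_def)

lemma nth_degen:
  assumes "i \<le> length (snd p)" "k \<le> length (snd p)"
  shows "snd (path_degen C n i p) ! k =
    (if k < i then snd p ! k else if k = i then Ident C (vertex C p i) else snd p ! (k - 1))"
  using assms by (auto simp: path_degen_def nth_append nth_Cons' min_def)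

lemma vertex_degen:
  assumes "is_path C p" "i \<le> length (snd p)" "k \<le> length (snd p) + 1"
  shows "vertex C (path_degen C n i p) k = vertex C p (if k \<le> i then k else k - 1)"
proof (cases "k = 0")
  case True
  then show ?thesis by (auto simp: vertex_def path_degen_def)
next
  case False
  then have "Cod C (Ident C (vertex C p (k - 1))) = vertex C p (k - 1)"
    using assms by (intro cod_ident vertex_obj) auto
  then show ?thesis
    using nth_degen[OF assms(2), of "k - 1"] False assms(3)
    by (auto simp: vertex_def)
qed

lemma is_path_face:
  assumes "1 \<le> n" "i \<le> n" "is_path C p" "length (snd p) = n"
  shows "is_path C (path_face C n i p)"
proof (rule is_pathI)
  show "vertex C (path_face C n i p) 0 \<in> Obj C"
    using assms by (auto simp: vertex_face intro: vertex_obj)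
next
  fix k assume "k < length (snd (path_face C n i p))"
  then have k: "k < n - 1" using assms by (simp add: length_face)
  then show "snd (path_face C n i p) ! k \<in> Arr C \<and>
      Dom C (snd (path_face C n i p) ! k) = vertex C (path_face C n i p) k"
    using assms path_arr[OF assms(3), of k] path_arr[OF assms(3), of "k + 1"]
      path_dom[OF assms(3), of k] path_dom[OF assms(3), of "k + 1"] path_cod[of p k]
    by (auto simp: nth_face vertex_face comp_arr dom_comp)
qed

lemma is_path_degen:
  assumes "i \<le> length (snd p)" "is_path C p"
  shows "is_path C (path_degen C n i p)"
proof (rule is_pathI)
  show "vertex C (path_degen C n i p) 0 \<in> Obj C"
    using assms by (auto simp: vertex_degen intro: vertex_obj)
next
  fix k assume "k < length (snd (path_degen C n i p))"
  then have k: "k \<le> length (snd p)" using assms by (simp add: length_degen)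
  then show "snd (path_degen C n i p) ! k \<in> Arr C \<and>
      Dom C (snd (path_degen C n i p) ! k) = vertex C (path_degen C n i p) k"
    using assms path_arr[OF assms(2), of k] path_arr[OF assms(2), of "k - 1"]
      path_dom[OF assms(2), of k] path_dom[OF assms(2), of "k - 1"]
      vertex_obj[OF assms(2), of i]
    by (auto simp: nth_degen vertex_degen ident_arr dom_ident)
qed

lemma fst_eq_vertex: "fst p = vertex C p 0"
  by (simp add: vertex_def)

theorem simplicial_set_nerve: "simplicial_set (nerve C)"
proof
  have F: "Face (nerve C) = path_face C" and G: "Degen (nerve C) = path_degen C"
    by (simp_all add: nerve_def)
  fix n p assume p: "p \<in> Simp (nerve C) n"
  then have path: "is_path C p" and len: "length (snd p) = n" by (simp_all add: Simp_nerve)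
  note path_facts = path_arr[OF path] path_dom[OF path] vertex_obj[OF path] path_cod[of p]
  show "Face (nerve C) n i p \<in> Simp (nerve C) (n - 1)" if "1 \<le> n" "i \<le> n" for i
    using that path len by (simp add: F Simp_nerve is_path_face length_face)
  show "Degen (nerve C) n i p \<in> Simp (nerve C) (n + 1)" if "i \<le> n" for i
    using that path len by (simp add: G Simp_nerve is_path_degen length_degen)
  show "Face (nerve C) (n - 1) i (Face (nerve C) n j p) =
      Face (nerve C) (n - 1) (j - 1) (Face (nerve C) n i p)" if "2 \<le> n" "i < j" "j \<le> n" for i j
    unfolding F
  proof (rule path_eqI)
    show "fst (path_face C (n - 1) i (path_face C n j p)) =
        fst (path_face C (n - 1) (j - 1) (path_face C n i p))"
      using that path len
      by (auto simp: fst_eq_vertex vertex_face is_path_face length_face)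
    show "length (snd (path_face C (n - 1) i (path_face C n j p))) =
        length (snd (path_face C (n - 1) (j - 1) (path_face C n i p)))"
      using that path len by (auto simp: length_face)
    fix k assume "k < length (snd (path_face C (n - 1) i (path_face C n j p)))"
    then have k: "k < n - 1 - 1" using that path len by (auto simp: length_face)
    have "Comp C (snd p ! (k + 2)) (Comp C (snd p ! (k + 1)) (snd p ! k)) =
        Comp C (Comp C (snd p ! (k + 2)) (snd p ! (k + 1))) (snd p ! k)"
      using k len by (intro comp_assoc) (auto simp: path_facts)
    then show "snd (path_face C (n - 1) i (path_face C n j p)) ! k =
        snd (path_face C (n - 1) (j - 1) (path_face C n i p)) ! k"
      using that k path len by (auto simp: nth_face length_face)
  qed
  show "Degen (nerve C) (n + 1) i (Degen (nerve C) n j p) =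
      Degen (nerve C) (n + 1) (j + 1) (Degen (nerve C) n i p)" if "i \<le> j" "j \<le> n" for i j
    unfolding G
    using that path len
    by (intro path_eqI)
      (auto simp: fst_eq_vertex vertex_degen is_path_degen nth_degen length_degen)
  show "Face (nerve C) (n + 1) i (Degen (nerve C) n j p) =
      Degen (nerve C) (n - 1) (j - 1) (Face (nerve C) n i p)" if "i < j" "j \<le> n" for i j
    unfolding F G
    using that path len
    by (intro path_eqI)
      (auto simp: fst_eq_vertex vertex_face vertex_degen is_path_face is_path_degen
        nth_face nth_degen length_face length_degen)
  show "Face (nerve C) (n + 1) i (Degen (nerve C) n j p) = p" if "i = j \<or> i = j + 1" "j \<le> n" for i j
    unfolding F G
  proof (rule path_eqI)
    show "fst (path_face C (n + 1) i (path_degen C n j p)) = fst p"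
      using that path len
      by (auto simp: fst_eq_vertex vertex_face vertex_degen is_path_degen length_degen)
    show *: "length (snd (path_face C (n + 1) i (path_degen C n j p))) = length (snd p)"
      using that path len by (auto simp: length_face length_degen)
    fix k assume "k < length (snd (path_face C (n + 1) i (path_degen C n j p)))"
    then have k: "k < n" using * len by simp
    have "Comp C (snd p ! k) (Ident C (vertex C p k)) = snd p ! k"
      "Comp C (Ident C (vertex C p (k + 1))) (snd p ! k) = snd p ! k"
      using k len comp_ident[of "snd p ! k"] ident_comp[of "snd p ! k"] by (auto simp: path_facts)
    then show "snd (path_face C (n + 1) i (path_degen C n j p)) ! k = snd p ! k"
      using that k path len by (auto simp: nth_face nth_degen length_degen)
  qed
  show "Face (nerve C) (n + 1) i (Degen (nerve C) n j p) =
      Degen (nerve C) (n - 1) j (Face (nerve C) n (i - 1) p)" if "j + 1 < i" "i \<le> n + 1" for i j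
    unfolding F G
    using that path len
    by (intro path_eqI)
      (auto simp: fst_eq_vertex vertex_face vertex_degen is_path_face is_path_degen
        nth_face nth_degen length_face length_degen)
qed

end

end

theory Submission
  imports Defs
begin

text \<open>
  A duplicial structure on the nerve and a left adjoint of \<open>\<pi>\<close> both amount to the same small piece of
  data on the category itself, here called a rotation: an operation sending each object \<open>A\<close> to an
  object \<open>T A\<close> and each arrow \<open>f : A \<rightarrow> B\<close> to an arrow \<open>rot f : T B \<rightarrow> A\<close> such that
  \<open>f \<circ> rot (g \<circ> f) = rot g\<close> and \<open>rot (rot 1\<^sub>A) = 1\<close>.

  The values of a duplicial operator on objects and arrows form a rotation
  (\<open>rotation_of_duplicial\<close>). Conversely, a rotation lets one prolong a path \<open>A\<^sub>0 \<rightarrow> \<dots> \<rightarrow> A\<^sub>n\<close> with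
  composite \<open>h\<close> on the left by \<open>rot h : T A\<^sub>n \<rightarrow> A\<^sub>0\<close>. This prolongation \<open>\<sigma>\<close> behaves like an extra degeneracy
  of the nerve, and on any simplicial set such a \<open>\<sigma>\<close> yields the duplicial operator \<open>d\<^sub>n\<^sub>+\<^sub>1 \<sigma>\<close>
  (\<open>duplicial_of_extra_degeneracy\<close>, \<open>duplicial_nerve\<close>).

  From a rotation, \<open>T f = rot (rot f)\<close> is an endofunctor with a natural transformation
  \<open>\<epsilon>\<^sub>A = rot 1\<^sub>A : T A \<rightarrow> A\<close>. Since \<open>rot \<epsilon>\<^sub>B\<close> is an identity, every arrow \<open>f\<close> into an object \<open>T B\<close> satisfies
  \<open>f \<circ> rot (\<epsilon>\<^sub>B \<circ> f) = 1\<close> and so is a split epimorphism. If \<open>f : T A \<rightarrow> T B\<close>, this applies to the section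
  of \<open>f\<close> as well, so \<open>f\<close> is invertible (\<open>iso_between_T\<close>). In particular every \<open>T f\<close> is invertible, and \<open>T\<close>
  extends to a functor \<open>L\<close> on the fundamental groupoid, which is left adjoint to \<open>\<pi>\<close> with counit \<open>\<epsilon>\<close>
  and unit \<open>(\<pi> \<epsilon>)\<^sup>-\<^sup>1\<close>; the triangle identities come down to \<open>T \<epsilon>\<^sub>A = \<epsilon>\<^sub>T\<^sub>A\<close> (\<open>left_adjoint_pi_func\<close>).
  Conversely, a left adjoint \<open>L\<close> of \<open>\<pi>\<close> with counit \<open>\<epsilon>\<close> gives the rotation \<open>rot f = \<epsilon> \<circ> L (\<pi> f)\<^sup>-\<^sup>1\<close>
  (\<open>rotation_of_left_adjoint\<close>).
\<close>

section \<open>Rotations of a category\<close>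

text \<open>
  Read \<open>rot f\<close> as \<open>t f\<close>. The first equation is the relation \<open>d\<^sub>1 t = t d\<^sub>0\<close> on the 2-simplex formed by \<open>f\<close> and
  \<open>g\<close>, and is called the triangle equation below; the second is the relation \<open>s\<^sub>0 t = t\<^sup>2 s\<^sub>0\<close> on the object \<open>A\<close>.
\<close>

locale rotation = category C for C :: "('o, 'a) cat" +
  fixes T :: "'o \<Rightarrow> 'o" and rot :: "'a \<Rightarrow> 'a"
  assumes rot_arr: "f \<in> Arr C \<Longrightarrow> rot f \<in> Arr C"
    and dom_rot: "f \<in> Arr C \<Longrightarrow> Dom C (rot f) = T (Cod C f)"
    and cod_rot: "f \<in> Arr C \<Longrightarrow> Cod C (rot f) = Dom C f"
    and comp_rot: "\<lbrakk>f \<in> Arr C; g \<in> Arr C; Cod C f = Dom C g\<rbrakk> \<Longrightarrow> Comp C f (rot (Comp C g f)) = rot g"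
    and rot_rot_ident: "A \<in> Obj C \<Longrightarrow> rot (rot (Ident C A)) = Ident C (T A)"
begin

definition eps :: "'o \<Rightarrow> 'a" where
  "eps A = rot (Ident C A)"

lemma eps:
  assumes "A \<in> Obj C"
  shows "eps A \<in> Arr C" "Dom C (eps A) = T A" "Cod C (eps A) = A"
  using assms by (simp_all add: eps_def rot_arr dom_rot cod_rot ident_arr dom_ident cod_ident)

lemma T_obj: "A \<in> Obj C \<Longrightarrow> T A \<in> Obj C"
  using dom_obj[of "eps A"] by (simp add: eps)

lemma rot_eps: "A \<in> Obj C \<Longrightarrow> rot (eps A) = Ident C (T A)"
  by (simp add: eps_def rot_rot_ident)

lemma comp_rot_self: "f \<in> Arr C \<Longrightarrow> Comp C f (rot f) = eps (Cod C f)"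
  using comp_rot[of f "Ident C (Cod C f)"]
  by (simp add: eps_def ident_arr dom_ident ident_comp cod_obj)

text \<open>
  Applying the triangle equation to the composable pair \<open>rot (g \<circ> f)\<close>, \<open>f\<close>, whose composite is \<open>rot g\<close>,
  moves the rotation around once more.
\<close>

lemma rot_comp_rot_rot:
  assumes "f \<in> Arr C" "g \<in> Arr C" "Cod C f = Dom C g"
  shows "Comp C (rot (Comp C g f)) (rot (rot g)) = rot f"
  using comp_rot[of "rot (Comp C g f)" f] assms by (simp add: comp_rot rot_arr cod_rot comp_arr dom_comp)

lemma rot_rot_comp:
  assumes "f \<in> Arr C" "g \<in> Arr C" "Cod C f = Dom C g"
  shows "rot (rot (Comp C g f)) = Comp C (rot (rot g)) (rot (rot f))"
  using comp_rot[of "rot (rot g)" "rot (Comp C g f)"] assms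
  by (simp add: rot_comp_rot_rot rot_arr dom_rot cod_rot comp_arr cod_comp)

definition T_func :: "('o, 'a, 'o, 'a) func" where
  "T_func = \<lparr>fobj = T, farr = (\<lambda>f. rot (rot f))\<rparr>"

lemma functor_T: "is_functor C C T_func"
  by unfold_locales
    (simp_all add: T_func_def rot_arr T_obj dom_rot cod_rot rot_rot_ident rot_rot_comp)

lemma eps_natural:
  assumes "f \<in> Arr C"
  shows "Comp C f (eps (Dom C f)) = Comp C (eps (Cod C f)) (rot (rot f))"
proof -
  have "Comp C f (eps (Dom C f)) = Comp C f (Comp C (rot f) (rot (rot f)))"
    using comp_rot_self[of "rot f"] assms by (simp add: rot_arr cod_rot)
  also have "\<dots> = Comp C (Comp C f (rot f)) (rot (rot f))"
    using assms by (intro comp_assoc) (auto simp: rot_arr dom_rot cod_rot)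
  finally show ?thesis using assms by (simp add: comp_rot_self)
qed

lemma T_eps: "A \<in> Obj C \<Longrightarrow> rot (rot (eps A)) = eps (T A)"
  by (simp add: rot_eps eps_def[symmetric])

text \<open>The triangle equation for the pair \<open>f\<close>, \<open>\<epsilon>\<^sub>B\<close>, since \<open>rot \<epsilon>\<^sub>B\<close> is an identity.\<close>

lemma right_inverse_into_T:
  assumes "f \<in> Arr C" "B \<in> Obj C" "Cod C f = T B"
  shows "Comp C f (rot (Comp C (eps B) f)) = Ident C (T B)"
  using comp_rot[of f "eps B"] assms by (simp add: eps rot_eps)

text \<open>
  A right inverse of an arrow into \<open>T B\<close> starts at \<open>T B\<close> and ends at the domain \<open>T A\<close>, so it has a right
  inverse as well, and a split epimorphism with a split epi section is invertible.
\<close>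

lemma iso_between_T:
  assumes f: "f \<in> Arr C" and AB: "A \<in> Obj C" "B \<in> Obj C"
    and dom: "Dom C f = T A" and cod: "Cod C f = T B"
  shows "iso_arrow C f"
proof -
  define g where "g = rot (Comp C (eps B) f)"
  have g: "g \<in> Arr C" "Dom C g = T B" "Cod C g = T A"
    using f AB dom cod
    by (simp_all add: g_def rot_arr dom_rot cod_rot comp_arr dom_comp cod_comp eps)
  define h where "h = rot (Comp C (eps A) g)"
  have h: "h \<in> Arr C" "Dom C h = T A" "Cod C h = T B"
    using g AB by (simp_all add: h_def rot_arr dom_rot cod_rot comp_arr dom_comp cod_comp eps)
  have fg: "Comp C f g = Ident C (T B)"
    unfolding g_def by (rule right_inverse_into_T[OF f AB(2) cod])
  have gh: "Comp C g h = Ident C (T A)"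
    unfolding h_def by (rule right_inverse_into_T[OF g(1) AB(1) g(3)])
  have "Comp C f (Comp C g h) = Comp C (Comp C f g) h"
    using f dom g h by (intro comp_assoc) auto
  then have "f = h"
    using comp_ident[OF f] ident_comp[OF h(1)] by (simp add: fg gh dom h)
  with gh fg show ?thesis
    using f g dom cod unfolding iso_arrow_def inverse_arrows_def by auto
qed

lemma T_inverts: "f \<in> Arr C \<Longrightarrow> iso_arrow C (farr T_func f)"
  by (rule iso_between_T[of _ "Dom C f" "Cod C f"])
    (simp_all add: T_func_def rot_arr dom_rot cod_rot dom_obj cod_obj)

end

section \<open>Natural transformations out of the fundamental groupoid\<close>

context category
begin

lemma comp_assoc4:
  assumes "f \<in> Arr C" "g \<in> Arr C" "h \<in> Arr C" "k \<in> Arr C"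
    and "Cod C f = Dom C g" "Cod C g = Dom C h" "Cod C h = Dom C k"
  shows "Comp C (Comp C k h) (Comp C g f) = Comp C k (Comp C (Comp C h g) f)"
proof -
  have "Comp C (Comp C k h) (Comp C g f) = Comp C k (Comp C h (Comp C g f))"
    using assms by (intro comp_assoc[symmetric]) (simp_all add: comp_arr cod_comp)
  also have "Comp C h (Comp C g f) = Comp C (Comp C h g) f"
    using assms by (intro comp_assoc)
  finally show ?thesis .
qed

lemma square_paste:
  assumes "f \<in> Arr C" "f' \<in> Arr C" "a \<in> Arr C" "b \<in> Arr C" "c \<in> Arr C" "g \<in> Arr C" "g' \<in> Arr C"
    and "Cod C f = Dom C f'" "Cod C g = Dom C g'"
    and "Dom C a = Dom C f" "Dom C b = Cod C f" "Dom C c = Cod C f'"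
    and "Cod C a = Dom C g" "Cod C b = Dom C g'" "Cod C c = Cod C g'"
    and "Comp C g a = Comp C b f" "Comp C g' b = Comp C c f'"
  shows "Comp C (Comp C g' g) a = Comp C c (Comp C f' f)"
proof -
  have "Comp C (Comp C g' g) a = Comp C g' (Comp C g a)"
    using assms by (intro comp_assoc[symmetric]) auto
  also have "\<dots> = Comp C (Comp C g' b) f"
    unfolding assms(16) using assms(1-15) by (intro comp_assoc) auto
  also have "\<dots> = Comp C c (Comp C f' f)"
    unfolding assms(17) using assms(1-15) by (intro comp_assoc[symmetric]) auto
  finally show ?thesis .
qed

lemma square_inverse:
  assumes f: "inverse_arrows C f f'" and g: "inverse_arrows C g g'"
    and ab: "a \<in> Arr C" "b \<in> Arr C" "Dom C a = Dom C f" "Dom C b = Cod C f"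
      "Cod C a = Dom C g" "Cod C b = Cod C g"
    and sq: "Comp C g a = Comp C b f"
  shows "Comp C g' b = Comp C a f'"
proof -
  note fg = f[unfolded inverse_arrows_def] g[unfolded inverse_arrows_def]
  have "Comp C g' b = Comp C g' (Comp C b (Comp C f f'))"
    using fg ab comp_ident[of b] by simp
  also have "Comp C b (Comp C f f') = Comp C (Comp C b f) f'"
    using fg ab by (intro comp_assoc) auto
  also have "Comp C g' (Comp C (Comp C b f) f') = Comp C (Comp C g' g) (Comp C a f')"
    unfolding sq[symmetric] using fg ab by (intro comp_assoc4[symmetric]) auto
  also have "\<dots> = Comp C a f'"
    using fg ab ident_comp[of "Comp C a f'"] by (simp add: comp_arr cod_comp)
  finally show ?thesis .
qed

lemma right_inverse_eq_inverse:
  assumes f: "inverse_arrows C f g" and h: "h \<in> Arr C" "Dom C h = Cod C f" "Cod C h = Dom C f"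
    and fh: "Comp C f h = Ident C (Cod C f)"
  shows "h = g"
proof -
  note fg = f[unfolded inverse_arrows_def]
  have "Comp C g (Comp C f h) = Comp C (Comp C g f) h"
    using fg h by (intro comp_assoc) auto
  then show ?thesis using fg h ident_comp[OF h(1)] comp_ident[of g] by (simp add: fh)
qed

lemma inverse_comp:
  assumes f: "inverse_arrows C f f'" and g: "inverse_arrows C g g'" and fg: "Cod C f = Dom C g"
  shows "inverse_arrows C (Comp C g f) (Comp C f' g')"
proof -
  note * = f[unfolded inverse_arrows_def] g[unfolded inverse_arrows_def]
  have "Comp C (Comp C f' g') (Comp C g f) = Comp C f' (Comp C (Comp C g' g) f)"
    using * fg by (intro comp_assoc4) auto
  moreover have "Comp C (Comp C g f) (Comp C f' g') = Comp C g (Comp C (Comp C f f') g')"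
    using * fg by (intro comp_assoc4) auto
  ultimately show ?thesis
    using * fg ident_comp[of f] ident_comp[of g'] unfolding inverse_arrows_def
    by (simp add: comp_arr dom_comp cod_comp)
qed

lemma zigzag_single: "step_arr x \<in> Arr C \<Longrightarrow> zigzag C (step_src C x) (step_trg C x) [x]"
  by (simp add: step_trg_obj)

lemma inverse_pi_func:
  assumes "f \<in> Arr C"
  shows "inverse_arrows (Pi1 C) (farr (pi_func C) f) (zz_class C (Cod C f) (Dom C f) [Bwd f])"
proof -
  have z: "zigzag C (Dom C f) (Cod C f) [Fwd f]" "zigzag C (Cod C f) (Dom C f) [Bwd f]"
    using assms zigzag_single[of "Fwd f"] zigzag_single[of "Bwd f"] by simp_all
  then show ?thesis
    using zz_fwd_bwd[OF assms] zz_bwd_fwd[OF assms] zigzag_append[OF z] zigzag_append[OF z(2,1)]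
    unfolding inverse_arrows_def
    by (simp add: pi_func_def Pi1_simps Comp_zz_class Arr_Pi1I zz_class_eq_iff)
qed

text \<open>
  The two-dimensional part of the universal property of the localisation. A naturality square for \<open>f\<close>
  gives one for the inverse of \<open>f\<close>, and every arrow of the fundamental groupoid is a composite of
  such forward and backward steps.
\<close>

lemma Pi1_nat_trans:
  assumes F: "is_functor (Pi1 C) D F" and G: "is_functor (Pi1 C) D G"
    and \<alpha>: "nat_trans C D (comp_func F (pi_func C)) (comp_func G (pi_func C)) \<alpha>"
  shows "nat_trans (Pi1 C) D F G \<alpha>"
proof -
  interpret F: is_functor "Pi1 C" D F by fact
  interpret G: is_functor "Pi1 C" D G by fact
  have \<alpha>_arr: "\<alpha> A \<in> Arr D" "Dom D (\<alpha> A) = fobj F A" "Cod D (\<alpha> A) = fobj G A" if "A \<in> Obj C" for A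
    using \<alpha> that by (simp_all add: nat_trans_def comp_func_def pi_func_def)
  have \<alpha>_nat: "Comp D (farr G (farr (pi_func C) f)) (\<alpha> (Dom C f)) =
      Comp D (\<alpha> (Cod C f)) (farr F (farr (pi_func C) f))" if "f \<in> Arr C" for f
    using \<alpha> that by (simp add: nat_trans_def comp_func_def)
  have F_arr: "farr F (zz_class C A B w) \<in> Arr D"
    "Dom D (farr F (zz_class C A B w)) = fobj F A" "Cod D (farr F (zz_class C A B w)) = fobj F B"
    if "zigzag C A B w" for A B w
    using that by (simp_all add: F.farr_arr F.farr_dom F.farr_cod Arr_Pi1I Pi1_simps)
  have G_arr: "farr G (zz_class C A B w) \<in> Arr D"
    "Dom D (farr G (zz_class C A B w)) = fobj G A" "Cod D (farr G (zz_class C A B w)) = fobj G B"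
    if "zigzag C A B w" for A B w
    using that by (simp_all add: G.farr_arr G.farr_dom G.farr_cod Arr_Pi1I Pi1_simps)
  have step: "Comp D (farr G (zz_class C (step_src C x) (step_trg C x) [x])) (\<alpha> (step_src C x)) =
      Comp D (\<alpha> (step_trg C x)) (farr F (zz_class C (step_src C x) (step_trg C x) [x]))"
    if x: "step_arr x \<in> Arr C" for x
  proof (cases x)
    case (Fwd f)
    then show ?thesis using \<alpha>_nat[of f] x by (simp add: pi_func_def)
  next
    case (Bwd f)
    then have f: "f \<in> Arr C" using x by simp
    have z: "zigzag C (Dom C f) (Cod C f) [Fwd f]"
      using zigzag_single[of "Fwd f"] f by simp
    have "Comp D (farr G (zz_class C (Cod C f) (Dom C f) [Bwd f])) (\<alpha> (Cod C f)) =
        Comp D (\<alpha> (Dom C f)) (farr F (zz_class C (Cod C f) (Dom C f) [Bwd f]))"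
      using F_arr(1-3)[OF z] G_arr(1-3)[OF z] \<alpha>_arr(1-3)[OF dom_obj[OF f]] \<alpha>_arr(1-3)[OF cod_obj[OF f]] \<alpha>_nat[OF f]
      by (intro F.tgt.square_inverse[OF F.functor_inverse[OF inverse_pi_func[OF f]]
            G.functor_inverse[OF inverse_pi_func[OF f]]])
        (simp_all add: pi_func_def)
    then show ?thesis by (simp add: Bwd)
  qed
  have "Comp D (farr G (zz_class C A B w)) (\<alpha> A) = Comp D (\<alpha> B) (farr F (zz_class C A B w))"
    if "zigzag C A B w" for A B w
    using that
  proof (induction w arbitrary: A)
    case Nil
    then have A: "A \<in> Obj C" "A = B" by auto
    then show ?case
      using \<alpha>_arr[OF A(1)] F.farr_ident[of A] G.farr_ident[of A]
        F.tgt.comp_ident[of "\<alpha> A"] F.tgt.ident_comp[of "\<alpha> A"]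
      by (simp add: Pi1_simps)
  next
    case (Cons x w)
    then have z: "zigzag C (step_src C x) (step_trg C x) [x]" "zigzag C (step_trg C x) B w"
      and A: "A = step_src C x" and x: "step_arr x \<in> Arr C"
      by (auto simp: step_trg_obj)
    have split: "zz_class C A B (x # w) =
        Comp (Pi1 C) (zz_class C (step_trg C x) B w) (zz_class C (step_src C x) (step_trg C x) [x])"
      using Comp_zz_class[OF z] A by simp
    have "farr F (zz_class C A B (x # w)) = Comp D (farr F (zz_class C (step_trg C x) B w))
        (farr F (zz_class C (step_src C x) (step_trg C x) [x]))"
      "farr G (zz_class C A B (x # w)) = Comp D (farr G (zz_class C (step_trg C x) B w))
        (farr G (zz_class C (step_src C x) (step_trg C x) [x]))"
      unfolding split using z by (simp_all add: F.farr_comp G.farr_comp Arr_Pi1I Pi1_simps)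
    then show ?case
      using F_arr[OF z(1)] F_arr[OF z(2)] G_arr[OF z(1)] G_arr[OF z(2)] zigzag_obj[OF z(1)]
        zigzag_obj[OF z(2)] step[OF x] Cons.IH[OF z(2)] A
      by (simp only:) (rule F.tgt.square_paste[of _ _ _ "\<alpha> (step_trg C x)"]; simp add: \<alpha>_arr)
  qed
  then show ?thesis
    unfolding nat_trans_def by (auto simp: \<alpha>_arr Pi1_simps elim!: Arr_Pi1E)
qed

end

section \<open>Rotations and left adjoints\<close>

text \<open>
  The unit \<open>\<eta>\<^sub>A\<close> is forced to be the inverse of \<open>\<pi> \<epsilon>\<^sub>A\<close> by one triangle identity. The other one then says
  that \<open>L (\<pi> \<epsilon>\<^sub>A) = T \<epsilon>\<^sub>A\<close> agrees with \<open>\<epsilon>\<^sub>T\<^sub>A\<close>.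
\<close>

lemma (in rotation) left_adjoint_pi_func: "has_left_adjoint C (Pi1 C) (pi_func C)"
proof -
  interpret T: is_functor C C T_func by (rule functor_T)
  interpret P: category "Pi1 C" by (rule category_Pi1)
  interpret pi: is_functor C "Pi1 C" "pi_func C" by (rule functor_pi_func)
  define L where "L = T.Pi1_lift"
  define \<eta> where "\<eta> X = zz_class C X (T X) [Bwd (eps X)]" for X
  have L: "is_functor (Pi1 C) C L"
    unfolding L_def by (rule T.functor_Pi1_lift[OF T_inverts])
  interpret L: is_functor "Pi1 C" C L by (rule L)
  have L_obj: "fobj L A = T A" if "A \<in> Obj C" for A
    using T.Pi1_lift_pi_func(1)[OF T_inverts that]
    by (simp add: L_def comp_func_def pi_func_def T_func_def)
  have L_arr: "farr L (farr (pi_func C) f) = rot (rot f)" if "f \<in> Arr C" for f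
    using T.Pi1_lift_pi_func(2)[OF T_inverts that]
    by (simp add: L_def comp_func_def T_func_def)
  have pi_obj: "fobj (pi_func C) A = A" for A by (simp add: pi_func_def)
  have \<eta>_inv: "inverse_arrows (Pi1 C) (farr (pi_func C) (eps A)) (\<eta> A)" if "A \<in> Obj C" for A
    using inverse_pi_func[of "eps A"] that by (simp add: eps \<eta>_def)
  have inv_sym: "inverse_arrows D g f" if "inverse_arrows D f g" for D :: "('x, 'y) cat" and f g
    using that by (auto simp: inverse_arrows_def)
  have \<eta>_arr: "\<eta> A \<in> Arr (Pi1 C)" "Dom (Pi1 C) (\<eta> A) = A" "Cod (Pi1 C) (\<eta> A) = T A"
    if "A \<in> Obj C" for A
    using \<eta>_inv[OF that] by (auto simp: inverse_arrows_def \<eta>_def Pi1_simps)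
  have pi_L: "is_functor (Pi1 C) (Pi1 C) (comp_func (pi_func C) L)"
    by unfold_locales
      (simp_all add: comp_func_def pi.farr_arr pi.fobj_obj pi.farr_dom pi.farr_cod pi.farr_ident
        pi.farr_comp L.farr_arr L.fobj_obj L.farr_dom L.farr_cod L.farr_ident L.farr_comp)
  have id: "is_functor (Pi1 C) (Pi1 C) id_func"
    by unfold_locales (simp_all add: id_func_def)
  have \<eta>_nat: "nat_trans (Pi1 C) (Pi1 C) id_func (comp_func (pi_func C) L) \<eta>"
  proof (rule Pi1_nat_trans[OF id pi_L])
    have "Comp (Pi1 C) (farr (pi_func C) (rot (rot f))) (\<eta> (Dom C f)) =
        Comp (Pi1 C) (\<eta> (Cod C f)) (farr (pi_func C) f)" if f: "f \<in> Arr C" for f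
    proof -
      \<comment> \<open>The square of \<open>\<eta>\<close> is the image under \<open>\<pi>\<close> of the square of \<open>\<epsilon>\<close> with two opposite sides inverted.\<close>
      let ?p = "farr (pi_func C)" and ?A = "Dom C f" and ?B = "Cod C f"
      have AB: "?A \<in> Obj C" "?B \<in> Obj C" using f by (simp_all add: dom_obj cod_obj)
      note arrs = f AB eps[OF AB(1)] eps[OF AB(2)]
      have "?p (Comp C f (eps ?A)) = ?p (Comp C (eps ?B) (rot (rot f)))"
        by (simp only: eps_natural[OF f])
      then have "Comp (Pi1 C) (?p (eps ?B)) (?p (rot (rot f))) = Comp (Pi1 C) (?p f) (?p (eps ?A))"
        using arrs by (simp add: pi.farr_comp rot_arr dom_rot cod_rot)
      then show ?thesis
        using arrs
        by (intro P.square_inverse[OF \<eta>_inv[OF AB(1)] \<eta>_inv[OF AB(2)], symmetric])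
          (simp_all add: pi.farr_arr pi.farr_dom pi.farr_cod rot_arr dom_rot cod_rot pi_obj)
    qed
    then show "nat_trans C (Pi1 C) (comp_func id_func (pi_func C))
        (comp_func (comp_func (pi_func C) L) (pi_func C)) \<eta>"
      by (simp add: nat_trans_def comp_func_def id_func_def pi_obj \<eta>_arr L_obj L_arr)
  qed
  have \<epsilon>_nat: "nat_trans C C (comp_func L (pi_func C)) id_func eps"
    by (simp add: nat_trans_def comp_func_def id_func_def pi_obj L_obj L_arr eps eps_natural)
  have tri_L: "Comp C (eps (fobj L X)) (farr L (\<eta> X)) = Ident C (fobj L X)" if X: "X \<in> Obj C" for X
  proof -
    have "inverse_arrows C (eps (T X)) (farr L (\<eta> X))"
      using L.functor_inverse[OF \<eta>_inv[OF X]] X by (simp add: L_arr eps T_eps)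
    then show ?thesis using X by (simp add: inverse_arrows_def L_obj eps T_obj)
  qed
  have tri_pi: "Comp (Pi1 C) (farr (pi_func C) (eps A)) (\<eta> A) = Ident (Pi1 C) A"
    if "A \<in> Obj C" for A
    using \<eta>_inv[OF that] that by (simp add: inverse_arrows_def pi.farr_cod eps pi_obj)
  have "adjunction C (Pi1 C) L (pi_func C) \<eta> eps"
    unfolding adjunction_def
    using functor_pi_func L \<eta>_nat \<epsilon>_nat tri_L tri_pi by (simp add: Pi1_simps pi_obj)
  then show ?thesis unfolding has_left_adjoint_def by blast
qed

text \<open>
  With \<open>rot f = \<epsilon> \<circ> L (\<pi> f)\<^sup>-\<^sup>1\<close>, the triangle equation is naturality of \<open>\<epsilon>\<close>. Moreover \<open>rot 1\<^sub>A = \<epsilon>\<^sub>A\<close>, and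
  \<open>rot \<epsilon>\<^sub>A = \<epsilon> \<circ> L (\<pi> \<epsilon>\<^sub>A)\<^sup>-\<^sup>1 = \<epsilon> \<circ> L \<eta>\<^sub>A\<close> is an identity because \<open>\<eta>\<^sub>A\<close>, being a right inverse of \<open>\<pi> \<epsilon>\<^sub>A\<close> in
  a groupoid, is its inverse.
\<close>

lemma (in category) rotation_of_left_adjoint:
  assumes "has_left_adjoint C (Pi1 C) (pi_func C)"
  shows "\<exists>T rot. rotation C T rot"
proof -
  obtain L \<eta> \<epsilon> where adj: "adjunction C (Pi1 C) L (pi_func C) \<eta> \<epsilon>"
    using assms by (auto simp: has_left_adjoint_def)
  interpret P: category "Pi1 C" by (rule category_Pi1)
  interpret pi: is_functor C "Pi1 C" "pi_func C" by (rule functor_pi_func)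
  interpret L: is_functor "Pi1 C" C L using adj by (simp add: adjunction_def)
  have pi_obj: "fobj (pi_func C) A = A" for A by (simp add: pi_func_def)
  define inv where "inv f = zz_class C (Cod C f) (Dom C f) [Bwd f]" for f
  define rot where "rot f = Comp C (\<epsilon> (Dom C f)) (farr L (inv f))" for f
  have \<epsilon>: "\<epsilon> A \<in> Arr C" "Dom C (\<epsilon> A) = fobj L A" "Cod C (\<epsilon> A) = A" if "A \<in> Obj C" for A
    using adj that by (simp_all add: adjunction_def nat_trans_def comp_func_def id_func_def pi_obj)
  have \<epsilon>_nat: "Comp C f (\<epsilon> (Dom C f)) = Comp C (\<epsilon> (Cod C f)) (farr L (farr (pi_func C) f))"
    if "f \<in> Arr C" for f
    using adj that by (simp add: adjunction_def nat_trans_def comp_func_def id_func_def)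
  have \<eta>: "\<eta> A \<in> Arr (Pi1 C)" "Dom (Pi1 C) (\<eta> A) = A" "Cod (Pi1 C) (\<eta> A) = fobj L A"
    if "A \<in> Obj C" for A
    using adj that
    by (simp_all add: adjunction_def nat_trans_def comp_func_def id_func_def pi_obj Pi1_simps)
  have inv: "inverse_arrows (Pi1 C) (farr (pi_func C) f) (inv f)" if "f \<in> Arr C" for f
    unfolding inv_def by (rule inverse_pi_func[OF that])
  have L_inv: "inverse_arrows C (farr L (farr (pi_func C) f)) (farr L (inv f))" if "f \<in> Arr C" for f
    by (rule L.functor_inverse[OF inv[OF that]])
  have inv_arr: "inv f \<in> Arr (Pi1 C)" "Dom (Pi1 C) (inv f) = Cod C f" "Cod (Pi1 C) (inv f) = Dom C f"
    if "f \<in> Arr C" for f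
    using inv[OF that] by (simp add: inverse_arrows_def) (simp_all add: inv_def Pi1_simps)
  have Linv_arr: "farr L (inv f) \<in> Arr C" "Dom C (farr L (inv f)) = fobj L (Cod C f)"
    "Cod C (farr L (inv f)) = fobj L (Dom C f)" if "f \<in> Arr C" for f
    using inv_arr[OF that] by (simp_all add: L.farr_arr L.farr_dom L.farr_cod)
  have Lpi_arr: "farr L (farr (pi_func C) f) \<in> Arr C"
    "Dom C (farr L (farr (pi_func C) f)) = fobj L (Dom C f)"
    "Cod C (farr L (farr (pi_func C) f)) = fobj L (Cod C f)" if "f \<in> Arr C" for f
    using that by (simp_all add: pi.farr_arr pi.farr_dom pi.farr_cod L.farr_arr L.farr_dom
        L.farr_cod pi_obj)
  have L_obj: "fobj L A \<in> Obj C" if "A \<in> Obj C" for A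
    using L.fobj_obj that by (simp add: Pi1_simps)
  have rot_arr: "rot f \<in> Arr C" "Dom C (rot f) = fobj L (Cod C f)" "Cod C (rot f) = Dom C f"
    if "f \<in> Arr C" for f
    using that Linv_arr[OF that] \<epsilon>[OF dom_obj[OF that]]
    by (simp_all add: rot_def comp_arr dom_comp cod_comp)
  have comp_self: "Comp C (farr L (farr (pi_func C) f)) (farr L (inv f)) =
      Ident C (fobj L (Cod C f))" if "f \<in> Arr C" for f
    using L_inv[OF that] Lpi_arr[OF that] by (simp add: inverse_arrows_def)
  have inv_comp: "inv (Comp C g f) = Comp (Pi1 C) (inv f) (inv g)"
    if fg: "f \<in> Arr C" "g \<in> Arr C" "Cod C f = Dom C g" for f g
  proof (rule P.inverse_arrows_unique[OF inv])
    show "Comp C g f \<in> Arr C" using fg by (rule comp_arr)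
    show "inverse_arrows (Pi1 C) (farr (pi_func C) (Comp C g f)) (Comp (Pi1 C) (inv f) (inv g))"
      unfolding pi.farr_comp[OF fg] using fg
      by (intro P.inverse_comp inv) (simp_all add: pi.farr_dom pi.farr_cod)
  qed
  have "rotation C (fobj L) rot"
  proof unfold_locales
    fix f assume f: "f \<in> Arr C"
    show "rot f \<in> Arr C" "Dom C (rot f) = fobj L (Cod C f)" "Cod C (rot f) = Dom C f"
      by (rule rot_arr[OF f])+
    fix g assume g: "g \<in> Arr C" and fg: "Cod C f = Dom C g"
    have "Comp C f (rot (Comp C g f)) =
        Comp C f (Comp C (\<epsilon> (Dom C f)) (Comp C (farr L (inv f)) (farr L (inv g))))"
      using f g fg by (simp add: rot_def inv_comp dom_comp L.farr_comp inv_arr)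
    also have "\<dots> = Comp C (Comp C f (\<epsilon> (Dom C f))) (Comp C (farr L (inv f)) (farr L (inv g)))"
      using f g fg by (intro comp_assoc) (simp_all add: \<epsilon> dom_obj Linv_arr comp_arr cod_comp)
    also have "\<dots> = Comp C (Comp C (\<epsilon> (Cod C f)) (farr L (farr (pi_func C) f)))
        (Comp C (farr L (inv f)) (farr L (inv g)))"
      using f by (simp add: \<epsilon>_nat)
    also have "\<dots> = Comp C (\<epsilon> (Cod C f))
        (Comp C (Comp C (farr L (farr (pi_func C) f)) (farr L (inv f))) (farr L (inv g)))"
      using f g fg \<epsilon>[OF cod_obj[OF f]] by (intro comp_assoc4) (simp_all add: Linv_arr Lpi_arr)
    also have "\<dots> = rot g"
      using f g fg ident_comp[of "farr L (inv g)"] by (simp add: comp_self Linv_arr rot_def)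
    finally show "Comp C f (rot (Comp C g f)) = rot g" .
  next
    fix A assume A: "A \<in> Obj C"
    note idA = ident_arr[OF A] dom_ident[OF A] cod_ident[OF A]
    have "rot (Ident C A) = \<epsilon> A"
    proof -
      let ?L = "farr L (farr (pi_func C) (Ident C A))" and ?L' = "farr L (inv (Ident C A))"
      note arrs = idA Linv_arr[OF idA(1)] Lpi_arr[OF idA(1)] \<epsilon>[OF A]
      have "rot (Ident C A) = Comp C (Comp C (Ident C A) (\<epsilon> A)) ?L'"
        using ident_comp[of "\<epsilon> A"] arrs by (simp add: rot_def)
      also have "Comp C (Ident C A) (\<epsilon> A) = Comp C (\<epsilon> A) ?L"
        using \<epsilon>_nat[OF idA(1)] idA by simp
      also have "Comp C (Comp C (\<epsilon> A) ?L) ?L' = Comp C (\<epsilon> A) (Comp C ?L ?L')"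
        using arrs by (intro comp_assoc[symmetric]) simp_all
      also have "\<dots> = \<epsilon> A"
        using comp_self[OF idA(1)] comp_ident[of "\<epsilon> A"] arrs by simp
      finally show ?thesis .
    qed
    moreover have "rot (\<epsilon> A) = Ident C (fobj L A)"
    proof -
      have "Comp (Pi1 C) (farr (pi_func C) (\<epsilon> A)) (\<eta> A) = Ident (Pi1 C) A"
        using adj A by (simp add: adjunction_def pi_obj)
      then have \<eta>_inv: "\<eta> A = inv (\<epsilon> A)"
        using \<eta>[OF A] \<epsilon>[OF A]
        by (intro P.right_inverse_eq_inverse[OF inv]) (simp_all add: pi.farr_dom pi.farr_cod pi_obj)
      then show ?thesis
        using adj A by (simp add: rot_def \<epsilon> adjunction_def Pi1_simps flip: \<eta>_inv)
    qed
    ultimately show "rot (rot (Ident C A)) = Ident C (fobj L A)" by simp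
  qed
  then show ?thesis by blast
qed

section \<open>Rotations and duplicial structures\<close>

text \<open>
  The arrow \<open>rot f\<close> is \<open>t\<close> applied to \<open>f\<close> as a 1-simplex. Applying \<open>t\<close> to a 2-simplex \<open>f\<close>, \<open>g\<close> and reading
  off the three faces shows that the result is the pair \<open>rot (g \<circ> f)\<close>, \<open>f\<close> with composite \<open>rot g\<close>.
\<close>

lemma (in category) rotation_of_duplicial:
  assumes "duplicial_structure (nerve C) t"
  shows "\<exists>T rot. rotation C T rot"
proof -
  have F: "Face (nerve C) = path_face C" and G: "Degen (nerve C) = path_degen C"
    by (simp_all add: nerve_def)
  have t_simp: "is_path C (t n p) \<and> length (snd (t n p)) = n" if "is_path C p" "length (snd p) = n" for n p
    using assms that by (simp add: duplicial_structure_def Simp_nerve)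
  have t_face: "path_face C n i (t n p) = t (n - 1) (path_face C n (i - 1) p)"
    if "is_path C p" "length (snd p) = n" "1 \<le> i" "i \<le> n" for n i p
    using assms that by (simp add: duplicial_structure_def Simp_nerve F)
  have t_face0: "path_face C n 0 (t n p) = path_face C n n p"
    if "is_path C p" "length (snd p) = n" "1 \<le> n" for n p
    using assms that by (simp add: duplicial_structure_def Simp_nerve F)
  have t_degen0: "path_degen C n 0 (t n p) = t (n + 1) (t (n + 1) (path_degen C n n p))"
    if "is_path C p" "length (snd p) = n" for n p
    using assms that by (simp add: duplicial_structure_def Simp_nerve G)
  define T where "T A = fst (t 0 (A, []))" for A
  define rot where "rot f = hd (snd (t 1 (Dom C f, [f])))" for f
  have t0: "t 0 (A, []) = (T A, [])" if "A \<in> Obj C" for A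
    using t_simp[of "(A, [])" 0] that by (auto simp: T_def is_path_def intro: prod_eqI)
  have path1: "is_path C (Dom C f, [f])" if "f \<in> Arr C" for f
    using that by (simp add: is_path_def dom_obj vertex_def)
  have t1: "t 1 (Dom C f, [f]) = (T (Cod C f), [rot f])" "rot f \<in> Arr C"
    "Dom C (rot f) = T (Cod C f)" "Cod C (rot f) = Dom C f" if f: "f \<in> Arr C" for f
  proof -
    obtain X g where tf: "t 1 (Dom C f, [f]) = (X, [g])"
      using t_simp[OF path1[OF f], of 1] by (cases "t 1 (Dom C f, [f])") (auto simp: length_Suc_conv)
    have g: "rot f = g" by (simp only: rot_def tf list.sel snd_conv)
    have "is_path C (X, [g])" using t_simp[OF path1[OF f], of 1] by (simp add: tf[simplified])
    then have *: "g \<in> Arr C" "Dom C g = X" by (auto simp: is_path_def vertex_def)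
    have "Cod C g = Dom C f"
      using t_face0[OF path1[OF f], of 1] by (simp add: tf[simplified] path_face_def vertex_def)
    moreover have "X = T (Cod C f)"
      using t_face[OF path1[OF f], of 1 1] t0[OF cod_obj[OF f]]
      by (simp add: tf[simplified] path_face_def vertex_def)
    ultimately show "t 1 (Dom C f, [f]) = (T (Cod C f), [rot f])" "rot f \<in> Arr C"
      "Dom C (rot f) = T (Cod C f)" "Cod C (rot f) = Dom C f"
      using tf g * by auto
  qed
  have comp_rot: "Comp C f (rot (Comp C g f)) = rot g"
    if f: "f \<in> Arr C" and g: "g \<in> Arr C" and fg: "Cod C f = Dom C g" for f g
  proof -
    let ?p = "(Dom C f, [f, g])"
    have path: "is_path C ?p"
      using f g fg by (auto simp: is_path_def dom_obj vertex_def nth_Cons')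
    note gf = comp_arr[OF f g fg] dom_comp[OF f g fg] cod_comp[OF f g fg]
    obtain X a b where tp: "t 2 ?p = (X, [a, b])"
      using t_simp[OF path, of 2] by (cases "t 2 ?p") (auto simp: length_Suc_conv numeral_2_eq_2)
    have "b = f"
      using t_face0[OF path, of 2] by (simp add: tp path_face_def vertex_def)
    moreover have "Comp C b a = rot g"
      using t_face[OF path, of 2 1] t1(1)[OF g] fg by (simp add: tp path_face_def vertex_def)
    moreover have "a = rot (Comp C g f)"
      using t_face[OF path, of 2 2] t1(1)[OF gf(1)] gf by (simp add: tp path_face_def vertex_def)
    ultimately show ?thesis by simp
  qed
  have rot_rot: "rot (rot (Ident C A)) = Ident C (T A)" if A: "A \<in> Obj C" for A
  proof -
    note idA = ident_arr[OF A] dom_ident[OF A] cod_ident[OF A]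
    have "is_path C (A, [])" using A by (simp add: is_path_def)
    from t_degen0[OF this, of 0] show ?thesis
      using t1[OF idA(1)] t1(1)[OF t1(2)[OF idA(1)]] idA
      by (simp add: path_degen_def vertex_def t0[OF A])
  qed
  have "rotation C T rot"
    by unfold_locales (simp_all add: t1 comp_rot rot_rot)
  then show ?thesis by blast
qed

text \<open>
  The operator \<open>\<sigma>\<close> behaves like a degeneracy placed before \<open>s\<^sub>0\<close>, except with respect to the last face;
  what \<open>\<sigma>\<close> followed by the last face does instead is the operator \<open>t\<close>. The last face commutes with the other
  faces and degeneracies, which gives the relations of \<open>t\<close> with \<open>d\<^sub>i\<close> for all \<open>i\<close> and with \<open>s\<^sub>j\<close> for \<open>j \<ge> 1\<close>.
  The one for \<open>s\<^sub>0\<close> holds because \<open>t s\<^sub>n = d\<^sub>n\<^sub>+\<^sub>2 \<sigma> s\<^sub>n = d\<^sub>n\<^sub>+\<^sub>2 s\<^sub>n\<^sub>+\<^sub>1 \<sigma> = \<sigma>\<close>, so that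
  \<open>t\<^sup>2 s\<^sub>n = d\<^sub>n\<^sub>+\<^sub>2 \<sigma>\<^sup>2 = d\<^sub>n\<^sub>+\<^sub>2 s\<^sub>0 \<sigma> = s\<^sub>0 t\<close>.
\<close>

lemma (in simplicial_set) duplicial_of_extra_degeneracy:
  fixes \<sigma> :: "'x \<Rightarrow> 'x"
  assumes \<sigma>_simp: "\<And>n x. x \<in> Simp X n \<Longrightarrow> \<sigma> x \<in> Simp X (n + 1)"
    and \<sigma>_face0: "\<And>n x. x \<in> Simp X n \<Longrightarrow> Face X (n + 1) 0 (\<sigma> x) = x"
    and \<sigma>_face: "\<And>n i x. \<lbrakk>x \<in> Simp X n; i < n\<rbrakk> \<Longrightarrow> Face X (n + 1) (i + 1) (\<sigma> x) = \<sigma> (Face X n i x)"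
    and \<sigma>_degen: "\<And>n j x. \<lbrakk>x \<in> Simp X n; j \<le> n\<rbrakk> \<Longrightarrow> Degen X (n + 1) (j + 1) (\<sigma> x) = \<sigma> (Degen X n j x)"
    and \<sigma>_degen0: "\<And>n x. x \<in> Simp X n \<Longrightarrow> Degen X (n + 1) 0 (\<sigma> x) = \<sigma> (\<sigma> x)"
  shows "duplicial_structure X (\<lambda>n x. Face X (n + 1) (n + 1) (\<sigma> x))"
  unfolding duplicial_structure_def
proof (intro conjI allI impI ballI)
  fix n x assume x: "x \<in> Simp X n"
  note \<sigma>x = \<sigma>_simp[OF x]
  show "Face X (n + 1) (n + 1) (\<sigma> x) \<in> Simp X n"
    using face_simp[OF _ _ \<sigma>x, of "n + 1"] by simp
  show "Degen X n j (Face X (n + 1) (n + 1) (\<sigma> x)) =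
      Face X (n + 1 + 1) (n + 1 + 1) (\<sigma> (Degen X n (j - 1) x))" if "1 \<le> j \<and> j \<le> n" for j
    using face_degen_greater[of j "n + 2" "n + 1" "\<sigma> x"] \<sigma>_degen[OF x, of "j - 1"] \<sigma>x that by fastforce
  have \<sigma>_eq: "Face X (n + 1 + 1) (n + 1 + 1) (\<sigma> (Degen X n n x)) = \<sigma> x"
    using face_degen_id[of "n + 2" "n + 1" "n + 1" "\<sigma> x"] \<sigma>_degen[OF x, of n] \<sigma>x by simp
  have "Degen X n 0 (Face X (n + 1) (n + 1) (\<sigma> x)) =
      Face X (n + 1 + 1) (n + 1 + 1) (Degen X (n + 1) 0 (\<sigma> x))"
    using face_degen_greater[of 0 "n + 2" "n + 1" "\<sigma> x"] \<sigma>x by (cases n) simp_all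
  then show "Degen X n 0 (Face X (n + 1) (n + 1) (\<sigma> x)) = Face X (n + 1 + 1) (n + 1 + 1)
      (\<sigma> (Face X (n + 1 + 1) (n + 1 + 1) (\<sigma> (Degen X n n x))))"
    by (simp only: \<sigma>_eq \<sigma>_degen0[OF x])
next
  fix n x assume n: "(1::nat) \<le> n" and x: "x \<in> Simp X n"
  note \<sigma>x = \<sigma>_simp[OF x]
  show "Face X n i (Face X (n + 1) (n + 1) (\<sigma> x)) =
      Face X (n - 1 + 1) (n - 1 + 1) (\<sigma> (Face X n (i - 1) x))" if "1 \<le> i \<and> i \<le> n" for i
    using face_face[of "n + 1" i "n + 1" "\<sigma> x"] \<sigma>_face[OF x, of "i - 1"] \<sigma>x that n by fastforce
  show "Face X n 0 (Face X (n + 1) (n + 1) (\<sigma> x)) = Face X n n x"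
    using face_face[of "n + 1" 0 "n + 1" "\<sigma> x"] \<sigma>_face0[OF x] \<sigma>x n by simp
qed

fun path_comp :: "('o, 'a) cat \<Rightarrow> 'o \<Rightarrow> 'a list \<Rightarrow> 'a" where
  "path_comp C A [] = Ident C A"
| "path_comp C A (f # fs) = Comp C (path_comp C (Cod C f) fs) f"

context category
begin

lemma is_path_Cons:
  "is_path C (A, f # fs) \<longleftrightarrow>
    A \<in> Obj C \<and> f \<in> Arr C \<and> Dom C f = A \<and> Cod C f \<in> Obj C \<and> is_path C (Cod C f, fs)"
proof -
  have "vertex C (A, f # fs) (Suc i) = vertex C (Cod C f, fs) i" for i
    by (cases i) (simp_all add: vertex_def)
  then show ?thesis
    using cod_obj by (auto simp: is_path_def All_less_Suc2) (auto simp: vertex_def)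
qed

lemma path_comp:
  assumes "is_path C (A, fs)"
  shows "path_comp C A fs \<in> Arr C" "Dom C (path_comp C A fs) = A"
  using assms
  by (induction fs arbitrary: A)
    (auto simp: is_path_Cons comp_arr dom_comp ident_arr dom_ident is_path_def[of C "(_, [])"])

lemma path_comp_merge:
  assumes "is_path C (A, us @ f # g # vs)"
  shows "path_comp C A (us @ Comp C g f # vs) = path_comp C A (us @ f # g # vs)"
  using assms
  by (induction us arbitrary: A)
    (auto simp: is_path_Cons cod_comp comp_assoc path_comp)

lemma path_comp_insert_ident:
  assumes "is_path C (A, us @ Ident C B # vs)" "B \<in> Obj C"
  shows "path_comp C A (us @ Ident C B # vs) = path_comp C A (us @ vs)"
  using assms
proof (induction us arbitrary: A)
  case Nil
  then show ?case
    using path_comp[of A vs] comp_ident[of "path_comp C A vs"]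
    by (auto simp: is_path_Cons dom_ident cod_ident)
qed (simp add: is_path_Cons)

lemma path_comp_face:
  assumes "is_path C p" "length (snd p) = n" "1 \<le> i" "i < n"
  shows "path_comp C (fst p) (snd (path_face C n i p)) = path_comp C (fst p) (snd p)"
proof -
  have "snd p = take (i - 1) (snd p) @ snd p ! (i - 1) # snd p ! i # drop (i + 1) (snd p)"
    using assms id_take_nth_drop[of "i - 1" "snd p"] Cons_nth_drop_Suc[of i "snd p"] by simp
  with path_comp_merge[of "fst p" "take (i - 1) (snd p)" "snd p ! (i - 1)" "snd p ! i"
      "drop (i + 1) (snd p)"] assms
  show ?thesis by (simp add: path_face_def)
qed

lemma path_comp_degen:
  assumes "is_path C p" "j \<le> length (snd p)"
  shows "path_comp C (fst p) (snd (path_degen C n j p)) = path_comp C (fst p) (snd p)"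
  using path_comp_insert_ident[of "fst p" "take j (snd p)" "vertex C p j" "drop j (snd p)"]
    is_path_degen[OF assms(2,1), of n] vertex_obj[OF assms]
  by (simp add: path_degen_def)

end

context rotation
begin

definition extend_path :: "('o, 'a) path \<Rightarrow> ('o, 'a) path" where
  "extend_path p = (let h = path_comp C (fst p) (snd p) in (T (Cod C h), rot h # snd p))"

text \<open>
  The inner faces and the degeneracies of a path do not change its composite. Dropping the first arrow
  does, and this case of \<open>d\<^sub>1 \<sigma> = \<sigma> d\<^sub>0\<close> is the triangle equation. For \<open>s\<^sub>0 \<sigma> = \<sigma>\<^sup>2\<close>, the
  composite of the path \<open>\<sigma> p\<close> is some \<open>\<epsilon>\<^sub>B\<close>, and \<open>rot \<epsilon>\<^sub>B\<close> is an identity.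
\<close>

lemma duplicial_nerve: "\<exists>t. duplicial_structure (nerve C) t"
proof -
  interpret N: simplicial_set "nerve C" by (rule simplicial_set_nerve)
  have F: "Face (nerve C) = path_face C" and G: "Degen (nerve C) = path_degen C"
    by (simp_all add: nerve_def)
  have "duplicial_structure (nerve C) (\<lambda>n x. Face (nerve C) (n + 1) (n + 1) (extend_path x))"
  proof (rule N.duplicial_of_extra_degeneracy)
    fix n p assume "p \<in> Simp (nerve C) n"
    then have path: "is_path C p" and len: "length (snd p) = n" by (simp_all add: Simp_nerve)
    obtain A fs where p: "p = (A, fs)" by (cases p)
    define h where "h = path_comp C A fs"
    have h: "h \<in> Arr C" "Dom C h = A" using path path_comp[of A fs] by (simp_all add: p h_def)
    have ext: "extend_path p = (T (Cod C h), rot h # fs)"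
      by (simp add: extend_path_def p h_def Let_def)
    have ext_path: "is_path C (T (Cod C h), rot h # fs)"
      using path h dom_obj[OF h(1)] cod_obj[OF h(1)]
      by (simp add: is_path_Cons p rot_arr dom_rot cod_rot T_obj)
    show "extend_path p \<in> Simp (nerve C) (n + 1)"
      using ext_path len unfolding ext by (simp add: Simp_nerve p)
    show "Face (nerve C) (n + 1) 0 (extend_path p) = p"
      using h unfolding ext by (simp add: F path_face_def vertex_def p cod_rot)
    show "Face (nerve C) (n + 1) (i + 1) (extend_path p) = extend_path (Face (nerve C) n i p)"
      if i: "i < n" for i
    proof (cases "i = 0")
      case True
      then obtain f gs where fs: "fs = f # gs" using i len p by (cases fs) auto
      define k where "k = path_comp C (Cod C f) gs"
      have f: "f \<in> Arr C" and k: "k \<in> Arr C" "Dom C k = Cod C f" and hk: "h = Comp C k f"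
        using path path_comp[of "Cod C f" gs] by (simp_all add: p fs is_path_Cons k_def h_def)
      have "Comp C f (rot h) = rot k" unfolding hk using f k by (intro comp_rot) auto
      moreover have "Cod C h = Cod C k" unfolding hk using f k by (intro cod_comp) auto
      ultimately show ?thesis
        using True i unfolding ext by (simp add: F) (simp add: extend_path_def path_face_def vertex_def p fs
            k_def Let_def)
    next
      case False
      have "path_comp C A (snd (path_face C n i p)) = h"
        using path_comp_face[OF path len, of i] False i by (simp add: p h_def)
      moreover have "fst (path_face C n i p) = A" using False i by (simp add: path_face_def p)
      moreover have "path_face C (n + 1) (i + 1) (T (Cod C h), rot h # fs) =
          (T (Cod C h), rot h # snd (path_face C n i p))"
        using False i by (cases i) (simp_all add: path_face_def p)
      ultimately show ?thesis unfolding ext by (simp add: F) (simp add: extend_path_def Let_def)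
    qed
    show "Degen (nerve C) (n + 1) (j + 1) (extend_path p) = extend_path (Degen (nerve C) n j p)"
      if j: "j \<le> n" for j
    proof -
      have "vertex C (T (Cod C h), rot h # fs) (j + 1) = vertex C p j"
        using h by (cases j) (simp_all add: vertex_def p cod_rot)
      moreover have "path_comp C A (snd (path_degen C n j p)) = h"
        using path_comp_degen[OF path, of j n] j len by (simp add: p h_def)
      ultimately show ?thesis
        unfolding ext by (simp add: G) (simp add: extend_path_def path_degen_def p Let_def)
    qed
    show "Degen (nerve C) (n + 1) 0 (extend_path p) = extend_path (extend_path p)"
    proof -
      let ?B = "Cod C h"
      have B: "?B \<in> Obj C" using h by (simp add: cod_obj)
      have "path_comp C (T ?B) (rot h # fs) = eps ?B"
        using h comp_rot_self[of h] by (simp add: cod_rot h_def)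
      then have "extend_path (extend_path p) = (T ?B, rot (eps ?B) # rot h # fs)"
        using B unfolding ext by (simp add: extend_path_def eps Let_def)
      then show ?thesis
        using B unfolding ext by (simp add: G path_degen_def vertex_def rot_eps)
    qed
  qed
  then show ?thesis by blast
qed

end

theorem corollary5p3p16:
  fixes C :: "('o, 'a) cat"
  assumes "category C"
  shows "(\<exists>t. duplicial_structure (nerve C) t) \<longleftrightarrow> has_left_adjoint C (Pi1 C) (pi_func C)"
proof
  assume "\<exists>t. duplicial_structure (nerve C) t"
  then obtain T rot where "rotation C T rot"
    using category.rotation_of_duplicial[OF assms] by blast
  then show "has_left_adjoint C (Pi1 C) (pi_func C)"
    by (rule rotation.left_adjoint_pi_func)
next
  assume "has_left_adjoint C (Pi1 C) (pi_func C)"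
  then obtain T rot where "rotation C T rot"
    using category.rotation_of_left_adjoint[OF assms] by blast
  then show "\<exists>t. duplicial_structure (nerve C) t"
    by (rule rotation.duplicial_nerve)
qed

end
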